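(* Let $k$ be a field of characteristic $0$, $R$ a unital associative $k$-algebra with involution, $\rho\in\{1,-1\}$, $n\ge3$, and let $\mathcal{J}$ be an ideal of the Lie algebra $\mathfrak{g}_{2n,\rho}(R)$. (1) The subsets $J_{i,j}=\{a\in R: f_{ij}(a)\in\mathcal{J}\}$, $J_{i,n+j}=\{a\in R: g_{ij}(a)\in\mathcal{J}\}$, $J_{n+i,j}=\{a\in R: h_{ij}(a)\in\mathcal{J}\}$ ($1\le i\neq j\le n$) are all involutive ideals of $R$, and each of the three families is independent of the choice of $(i,j)$ with $i\ne j$; denoting the common ideals by $J_1,J_2,J_3$ respectively, one has $J_1=J_2=J_3$. Call this ideal $J$. (2) For $1\le i\ne j\le n$ let $I_{ij}=\{a\in R: f_{ii}(a)-f_{jj}(a)\in\mathcal{J}\}$. Then $J=I_{ij}$ for all $1\le i\neq j\le n$. (3) For $1\le i\le n$ let $I_i=\{a\in R: f_{ii}(a)\in\mathcal{J}\}$. These sets are independent of $i$; denoting the common set by $I$, $$J_++[J,R]\subset I\subset(R_++[R,R])\cap J.$$ (4) For $1\le i\le n$ let $J_{i,n+i}=\{a\in R: g_{ii}(a)\in\mathcal{J}\}$ and $J_{n+i,i}=\{a\in R: h_{ii}(a)\in\mathcal{J}\}$. Then $\overline{J_{i,n+i}}=J_{i,n+i}$, $\overline{J_{n+i,i}}=J_{n+i,i}$, and both $J_{i,n+i}$ and $J_{n+i,i}$ contain $J$ and are contained in $J_{-\rho}\oplus R_\rho$. Furthermore $g_{ii}(J_{i,n+i})=g_{ii}(J)$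 and $h_{ii}(J_{n+i,i})=h_{ii}(J)$ for all $1\le i\le n$. (5) $\mathcal{J}$ has the vector space decomposition $$\mathcal{J}=\mathcal{J}_0\oplus\sum_{i\ne j}\mathcal{J}_{\epsilon_i-\epsilon_j}\oplus\sum_{i<j}(\mathcal{J}_{\epsilon_i+\epsilon_j}\oplus\mathcal{J}_{-\epsilon_i-\epsilon_j})\oplus\sum_i(\mathcal{J}_{2\epsilon_i}\oplus\mathcal{J}_{-2\epsilon_i}),$$ where $\mathcal{J}_\alpha=\mathcal{G}_\alpha\cap\mathcal{J}$ for all $\alpha\in\Delta_C$ and $$\mathcal{J}_0=\Big(\Big(\big(\sum_{i=1}^nf_{ii}\big)(R_++[R,R])\Big)\cap\mathcal{J}\Big)\oplus\Big(\Big(\sum_{i=2}^n(f_{ii}-f_{11})(R)\Big)\cap\mathcal{J}\Big).$$ Moreover, $$\widetilde{\mathfrak{g}_{2n,\rho}}(J)\supset\mathcal{J}\supset\underline{\mathfrak{g}_{2n,\rho}}(J).$$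
   Context: An involution on $R$ is a $k$-linear map $a\mapsto\bar a$ with $\overline{ab}=\bar b\,\bar a$, $\bar{\bar a}=a$. For $a\in R$, $e_{ij}(a)\in\mathfrak{gl}_{2n}(R)$ is the matrix with $a$ in position $(i,j)$ and $0$ elsewhere; for $1\le i,j\le n$, $f_{ij}(a)=e_{ij}(a)-e_{n+j,n+i}(\bar a)$, $g_{ij}(a)=e_{i,n+j}(a)-\rho e_{j,n+i}(\bar a)$, $h_{ij}(a)=e_{n+i,j}(a)-\rho e_{n+j,i}(\bar a)$. $\mathfrak{g}_{2n,\rho}(R)$ is the Lie subalgebra of $\mathfrak{gl}_{2n}(R)$ generated by all $f_{ij}(a)$ ($i\neq j$), $g_{ij}(a)$, $h_{ij}(a)$ ($i\le j$), $a\in R$. For $S\subset R$, $f_{ij}(S)=\{f_{ij}(a):a\in S\}$, etc.; $(f_{ii}-f_{11})(a)=f_{ii}(a)-f_{11}(a)$ and $(\sum_if_{ii})(a)=\sum_if_{ii}(a)$. $R_\pm=\{a\in R:\bar a=\pm a\}$ (so $R_\rho$, $R_{-\rho}$ are the $\rho$- and $-\rho$-eigenspaces); for a subspace $J$ closed under the involution $J_\pm=J\cap R_\pm$. $[R,R]$, $[J,R]$ are spans of commutators. An involutive ideal is a two-sided ideal closed under the involution. Roots: $\mathcal{H}=\{\sum_{i=1}^na_i(e_{ii}-e_{n+i,n+i}):a_i\in k\}$, $\epsilon_i\in\mathcal{H}^*$ is $\epsilon_i(\sum_ja_j(e_{jj}-e_{n+j,n+j}))=a_i$, and $\mathcal{G}_\alpha=\{x\in\mathfrak{g}_{2n,\rho}(R):[h,x]=\alpha(h)x\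 \forall h\in\mathcal{H}\}$. $\Delta_C=\{\epsilon_i-\epsilon_j\,(i\ne j),\ \pm(\epsilon_i+\epsilon_j)\,(i<j),\ \pm2\epsilon_i\}$. For an involutive ideal $J$ of $R$ let $\Delta(J)=\sum_{i\ne j}f_{ij}(J)\oplus\sum_{i\le j}(g_{ij}(J)\oplus h_{ij}(J))$, $\hat J=\{a\in R:[a,R]\subset J\}$, $\widehat{J_+}=\{a\in R:a+\bar a\in J\}$, and $$\widetilde{\mathfrak{g}_{2n,\rho}}(J)=\Big(\sum_{i=1}^nf_{ii}\Big)\big((R_++[R,R])\cap\hat J\cap\widehat{J_+}\big)+\sum_{i=2}^n(f_{ii}-f_{11})(J)+\Delta(J)$$ (a direct sum), $$\underline{\mathfrak{g}_{2n,\rho}}(J)=f_{11}(J_++[J,R])\oplus\sum_{i=2}^n(f_{ii}-f_{11})(J)\oplus\Delta(J).$$ *)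

theory Defs
  imports "HOL-Analysis.Analysis" "HOL-Library.Set_Algebras"
begin

text \<open>
  A unital associative algebra with involution over a field of characteristic 0. The class
  \<open>ring_1\<close> includes \<open>0 \<noteq> 1\<close>, which is needed for the functionals \<open>eps i\<close> below to be well defined
  on the Cartan subalgebra.
\<close>

locale involutive_algebra = vector_space smul
  for smul :: "'k::field_char_0 \<Rightarrow> 'r::ring_1 \<Rightarrow> 'r" +
  fixes bar :: "'r \<Rightarrow> 'r"
  assumes smul_mult_left: "smul c (a * b) = smul c a * b"
    and smul_mult_right: "smul c (a * b) = a * smul c b"
    and bar_linear: "Vector_Spaces.linear smul smul bar"
    and bar_mult: "bar (a * b) = bar b * bar a"
    and bar_bar: "bar (bar a) = a"

text \<open>
  Rows and columns \<open>1, \<dots>, 2n\<close> are indexed by \<open>'n + 'n\<close> with \<open>n = CARD('n)\<close>: \<open>Inl i\<close> stands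
  for \<open>i\<close> and \<open>Inr i\<close> for \<open>n + i\<close>. The linear order of \<open>'n\<close> is the order of \<open>1, \<dots>, n\<close>.
\<close>

type_synonym ('r, 'n) gl2n = "'r ^ ('n + 'n) ^ ('n + 'n)"

definition mscale :: "('k \<Rightarrow> 'r \<Rightarrow> 'r) \<Rightarrow> 'k \<Rightarrow> ('r, 'n::finite) gl2n \<Rightarrow> ('r, 'n) gl2n" where
  "mscale smul c = map_matrix (smul c)"

definition lie_bracket :: "('r::ring_1, 'n::finite) gl2n \<Rightarrow> ('r, 'n) gl2n \<Rightarrow> ('r, 'n) gl2n" where
  "lie_bracket x y = x ** y - y ** x"

definition lie_subalgebra ::
    "('k::field_char_0 \<Rightarrow> 'r::ring_1 \<Rightarrow> 'r) \<Rightarrow> ('r, 'n::finite) gl2n set \<Rightarrow> bool" where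
  "lie_subalgebra smul L \<longleftrightarrow>
     module.subspace (mscale smul) L \<and> (\<forall>x\<in>L. \<forall>y\<in>L. lie_bracket x y \<in> L)"

definition lie_ideal ::
    "('k::field_char_0 \<Rightarrow> 'r::ring_1 \<Rightarrow> 'r) \<Rightarrow> ('r, 'n::finite) gl2n set
      \<Rightarrow> ('r, 'n) gl2n set \<Rightarrow> bool" where
  "lie_ideal smul L K \<longleftrightarrow>
     K \<subseteq> L \<and> module.subspace (mscale smul) K \<and> (\<forall>x\<in>L. \<forall>y\<in>K. lie_bracket x y \<in> K)"

definition e_mat :: "'n + 'n \<Rightarrow> 'n + 'n \<Rightarrow> 'r::ring_1 \<Rightarrow> ('r, 'n::finite) gl2n" where
  "e_mat i j a = (\<chi> p q. if p = i \<and> q = j then a else 0)"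

definition f_mat :: "('r::ring_1 \<Rightarrow> 'r) \<Rightarrow> 'n \<Rightarrow> 'n \<Rightarrow> 'r \<Rightarrow> ('r, 'n::finite) gl2n" where
  "f_mat bar i j a = e_mat (Inl i) (Inl j) a - e_mat (Inr j) (Inr i) (bar a)"

definition g_mat :: "('k \<Rightarrow> 'r::ring_1 \<Rightarrow> 'r) \<Rightarrow> ('r \<Rightarrow> 'r) \<Rightarrow> 'k
    \<Rightarrow> 'n \<Rightarrow> 'n \<Rightarrow> 'r \<Rightarrow> ('r, 'n::finite) gl2n" where
  "g_mat smul bar \<rho> i j a = e_mat (Inl i) (Inr j) a - mscale smul \<rho> (e_mat (Inl j) (Inr i) (bar a))"

definition h_mat :: "('k \<Rightarrow> 'r::ring_1 \<Rightarrow> 'r) \<Rightarrow> ('r \<Rightarrow> 'r) \<Rightarrow> 'k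
    \<Rightarrow> 'n \<Rightarrow> 'n \<Rightarrow> 'r \<Rightarrow> ('r, 'n::finite) gl2n" where
  "h_mat smul bar \<rho> i j a = e_mat (Inr i) (Inl j) a - mscale smul \<rho> (e_mat (Inr j) (Inl i) (bar a))"

definition lie_g :: "('k::field_char_0 \<Rightarrow> 'r::ring_1 \<Rightarrow> 'r) \<Rightarrow> ('r \<Rightarrow> 'r) \<Rightarrow> 'k
    \<Rightarrow> ('r, 'n::{finite,linorder}) gl2n set" where
  "lie_g smul bar \<rho> = lie_subalgebra smul hull
     ({f_mat bar i j a |i j a. i \<noteq> j} \<union> {g_mat smul bar \<rho> i j a |i j a. i \<le> j} \<union>
      {h_mat smul bar \<rho> i j a |i j a. i \<le> j})"

text \<open>The set \<open>{a. bar a = c a}\<close>; thus \<open>R\<^sub>+\<close> is the case \<open>c = 1\<close>.\<close>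

definition bar_eigenspace :: "('k \<Rightarrow> 'r \<Rightarrow> 'r) \<Rightarrow> ('r \<Rightarrow> 'r) \<Rightarrow> 'k \<Rightarrow> 'r set" where
  "bar_eigenspace smul bar c = {a. bar a = smul c a}"

definition comm_span ::
    "('k::field_char_0 \<Rightarrow> 'r::ring_1 \<Rightarrow> 'r) \<Rightarrow> 'r set \<Rightarrow> 'r set \<Rightarrow> 'r set" where
  "comm_span smul A B = module.span smul {a * b - b * a |a b. a \<in> A \<and> b \<in> B}"

definition involutive_ideal ::
    "('k::field_char_0 \<Rightarrow> 'r::ring_1 \<Rightarrow> 'r) \<Rightarrow> ('r \<Rightarrow> 'r) \<Rightarrow> 'r set \<Rightarrow> bool" where
  "involutive_ideal smul bar J \<longleftrightarrow>
     module.subspace smul J \<and> (\<forall>a\<in>J. \<forall>r. r * a \<in> J \<and> a * r \<in> J) \<and> (\<forall>a\<in>J. bar a \<in> J)"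

definition cartan_elt ::
    "('k \<Rightarrow> 'r::ring_1 \<Rightarrow> 'r) \<Rightarrow> ('n \<Rightarrow> 'k) \<Rightarrow> ('r, 'n::finite) gl2n" where
  "cartan_elt smul a =
     (\<Sum>i\<in>UNIV. mscale smul (a i) (e_mat (Inl i) (Inl i) 1 - e_mat (Inr i) (Inr i) 1))"

definition cartan :: "('k \<Rightarrow> 'r::ring_1 \<Rightarrow> 'r) \<Rightarrow> ('r, 'n::finite) gl2n set" where
  "cartan smul = range (cartan_elt smul)"

text \<open>
  Elements of the dual of the Cartan subalgebra are represented by functions on all matrices, of
  which only the values on \<open>cartan smul\<close> matter.
\<close>

definition eps :: "('k \<Rightarrow> 'r::ring_1 \<Rightarrow> 'r) \<Rightarrow> 'n \<Rightarrow> ('r, 'n::finite) gl2n \<Rightarrow> 'k" where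
  "eps smul i h = inv (cartan_elt smul) h i"

definition root_space :: "('k::field_char_0 \<Rightarrow> 'r::ring_1 \<Rightarrow> 'r) \<Rightarrow> ('r \<Rightarrow> 'r) \<Rightarrow> 'k
    \<Rightarrow> (('r, 'n::{finite,linorder}) gl2n \<Rightarrow> 'k) \<Rightarrow> ('r, 'n) gl2n set" where
  "root_space smul bar \<rho> \<alpha> =
     {x \<in> lie_g smul bar \<rho>. \<forall>h\<in>cartan smul. lie_bracket h x = mscale smul (\<alpha> h) x}"

definition roots_C :: "('k::field_char_0 \<Rightarrow> 'r::ring_1 \<Rightarrow> 'r)
    \<Rightarrow> (('r, 'n::{finite,linorder}) gl2n \<Rightarrow> 'k) set" where
  "roots_C smul =
     {\<lambda>h. eps smul i h - eps smul j h |i j. i \<noteq> j} \<union>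
     {\<lambda>h. eps smul i h + eps smul j h |i j. i < j} \<union>
     {\<lambda>h. - (eps smul i h + eps smul j h) |i j. i < j} \<union>
     {\<lambda>h. 2 * eps smul i h |i. True} \<union>
     {\<lambda>h. - (2 * eps smul i h) |i. True}"

definition internal_direct_sum :: "('k::field_char_0 \<Rightarrow> 'v::ab_group_add \<Rightarrow> 'v)
    \<Rightarrow> 'i set \<Rightarrow> ('i \<Rightarrow> 'v set) \<Rightarrow> 'v set \<Rightarrow> bool" where
  "internal_direct_sum smul I W V \<longleftrightarrow>
     finite I \<and> (\<forall>i\<in>I. module.subspace smul (W i)) \<and>
     bij_betw (\<lambda>w. \<Sum>i\<in>I. w i) (Pi\<^sub>E I W) V"

text \<open>
  Sums of sets below are Minkowski sums; in particular \<open>\<Sum>\<close> over a family of sets is the sum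
  of the subspaces. The least element of \<open>'n\<close> plays the role of the index 1.
\<close>

definition fst_idx :: "'n::{finite,linorder}" where
  "fst_idx = Min UNIV"

definition f_scalar :: "('r::ring_1 \<Rightarrow> 'r) \<Rightarrow> 'r set \<Rightarrow> ('r, 'n::finite) gl2n set" where
  "f_scalar bar S = (\<lambda>a. \<Sum>i\<in>UNIV. f_mat bar i i a) ` S"

definition f_diff :: "('r::ring_1 \<Rightarrow> 'r) \<Rightarrow> 'r set \<Rightarrow> ('r, 'n::{finite,linorder}) gl2n set" where
  "f_diff bar S =
     (\<Sum>i\<in>UNIV - {fst_idx}. (\<lambda>a. f_mat bar i i a - f_mat bar fst_idx fst_idx a) ` S)"

definition Delta :: "('k \<Rightarrow> 'r::ring_1 \<Rightarrow> 'r) \<Rightarrow> ('r \<Rightarrow> 'r) \<Rightarrow> 'k \<Rightarrow> 'r set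
    \<Rightarrow> ('r, 'n::{finite,linorder}) gl2n set" where
  "Delta smul bar \<rho> J =
     (\<Sum>(i, j)\<in>{(i, j). i \<noteq> j}. f_mat bar i j ` J) +
     (\<Sum>(i, j)\<in>{(i, j). i \<le> j}. g_mat smul bar \<rho> i j ` J + h_mat smul bar \<rho> i j ` J)"

definition comm_hat :: "'r::ring_1 set \<Rightarrow> 'r set" where
  "comm_hat J = {a. \<forall>r. a * r - r * a \<in> J}"

definition plus_hat :: "('r::ring_1 \<Rightarrow> 'r) \<Rightarrow> 'r set \<Rightarrow> 'r set" where
  "plus_hat bar J = {a. a + bar a \<in> J}"

definition g_tilde :: "('k::field_char_0 \<Rightarrow> 'r::ring_1 \<Rightarrow> 'r) \<Rightarrow> ('r \<Rightarrow> 'r) \<Rightarrow> 'k \<Rightarrow> 'r set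
    \<Rightarrow> ('r, 'n::{finite,linorder}) gl2n set" where
  "g_tilde smul bar \<rho> J =
     f_scalar bar ((bar_eigenspace smul bar 1 + comm_span smul UNIV UNIV)
                     \<inter> comm_hat J \<inter> plus_hat bar J) +
     f_diff bar J + Delta smul bar \<rho> J"

definition g_under :: "('k::field_char_0 \<Rightarrow> 'r::ring_1 \<Rightarrow> 'r) \<Rightarrow> ('r \<Rightarrow> 'r) \<Rightarrow> 'k \<Rightarrow> 'r set
    \<Rightarrow> ('r, 'n::{finite,linorder}) gl2n set" where
  "g_under smul bar \<rho> J =
     f_mat bar fst_idx fst_idx ` ((J \<inter> bar_eigenspace smul bar 1) + comm_span smul J UNIV) +
     f_diff bar J + Delta smul bar \<rho> J"

end

theory Submission
  imports Defs
begin

text \<open>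
  Brackets of an element \<open>f\<^sub>i\<^sub>j(a)\<close>, \<open>g\<^sub>i\<^sub>j(a)\<close> or \<open>h\<^sub>i\<^sub>j(a)\<close> of the ideal with root vectors whose
  third index differs from \<open>i\<close> and \<open>j\<close> move \<open>a\<close> between all off-diagonal positions and multiply
  it by arbitrary ring elements; this yields the involutive ideal \<open>J\<close>. The ideal is stable under
  the Cartan subalgebra, which separates the roots, so it contains the weight components of its
  elements. A component of weight 0 is some \<open>\<Sum>\<^sub>i f\<^sub>i\<^sub>i(a\<^sub>i)\<close>; bracketing it with \<open>f\<^sub>i\<^sub>j(1)\<close> shows
  \<open>a\<^sub>i - a\<^sub>j \<in> J\<close>, and subtracting the average of the \<open>a\<^sub>i\<close> splits it into a scalar part and a part
  in \<open>\<Sum>\<^sub>i (f\<^sub>i\<^sub>i - f\<^sub>1\<^sub>1)(J)\<close>.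
\<close>

section \<open>Matrix units and Lie brackets\<close>

text \<open>Since \<open>lie_g\<close> is a hull, its elements are bounded from above by a larger
  subalgebra containing the generators: the matrices that are skew-adjoint for a \<rho>-hermitian
  form and have trace in [R, R]. Skewness ties the entry at (p, q) to the one at (opp q, opp p).
  These are exactly the off-diagonal positions of equal weight, so one entry determines a root
  component. The two positions merge for the long roots, the doubled \<epsilon>_i and their
  negatives: there g_ii and h_ii vanish on R_\<rho>, so only the part of a coefficient in
  R_{-\<rho>} can be recovered. This explains the form of claim (4) and the factors 1/2. The trace
  condition yields R_+ + [R, R], which no bracket with an element of the ideal would give. The
  average in weight 0 is forced: elements of \<open>f_diff\<close> have trace 0 in the upper left
  block, so a scalar part with entry c must satisfy n c = a_1 + ... + a_n.\<close>

lemma e_mat_nth [simp]: "e_mat i j a $ p $ q = (if p = i \<and> q = j then a else 0)"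
  by (simp add: e_mat_def)

lemma e_mat_0 [simp]: "e_mat i j 0 = 0"
  by (simp add: vec_eq_iff)

lemma e_mat_add: "e_mat i j (a + b) = e_mat i j a + e_mat i j b"
  by (simp add: vec_eq_iff)

lemma e_mat_diff: "e_mat i j (a - b) = e_mat i j a - e_mat i j b"
  by (simp add: vec_eq_iff)

lemma e_mat_minus: "e_mat i j (- a) = - e_mat i j a"
  by (simp add: vec_eq_iff)

lemma e_mat_mult:
  "e_mat i j a ** e_mat k l b = (if j = k then e_mat i l (a * b) else 0)"
proof -
  have "(\<Sum>r\<in>UNIV. e_mat i j a $ p $ r * e_mat k l b $ r $ q) =
      (\<Sum>r\<in>UNIV. if r = j then (if p = i \<and> j = k \<and> q = l then a * b else 0) else 0)" for p q
    by (rule sum.cong) auto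
  then show ?thesis
    by (auto simp: vec_eq_iff matrix_matrix_mult_def)
qed

lemma lie_bracket_nth:
  "lie_bracket x y $ p $ q = (\<Sum>r\<in>UNIV. x $ p $ r * y $ r $ q - y $ p $ r * x $ r $ q)"
  by (simp add: lie_bracket_def matrix_matrix_mult_def sum_subtractf)

lemma lie_bracket_add_right: "lie_bracket x (y + z) = lie_bracket x y + lie_bracket x z"
  by (simp add: vec_eq_iff lie_bracket_nth algebra_simps sum.distrib sum_subtractf)

lemma lie_bracket_diff_right: "lie_bracket x (y - z) = lie_bracket x y - lie_bracket x z"
  by (simp add: vec_eq_iff lie_bracket_nth algebra_simps sum.distrib sum_subtractf)

lemma lie_bracket_diff_left: "lie_bracket (x - y) z = lie_bracket x z - lie_bracket y z"
  by (simp add: vec_eq_iff lie_bracket_nth algebra_simps sum.distrib sum_subtractf)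

lemma lie_bracket_swap: "lie_bracket x y = - lie_bracket y x"
  by (simp add: lie_bracket_def)

lemma lie_bracket_0_right [simp]: "lie_bracket x 0 = 0"
  by (simp add: vec_eq_iff lie_bracket_nth)

lemma lie_bracket_sum_right: "lie_bracket x (\<Sum>i\<in>I. y i) = (\<Sum>i\<in>I. lie_bracket x (y i))"
  by (induction I rule: infinite_finite_induct) (simp_all add: lie_bracket_add_right)

lemma lie_bracket_sum_left: "lie_bracket (\<Sum>i\<in>I. y i) x = (\<Sum>i\<in>I. lie_bracket (y i) x)"
  by (subst lie_bracket_swap) (simp add: lie_bracket_sum_right sum_negf[symmetric] lie_bracket_swap[of x])

lemma lie_bracket_e_mat:
  "lie_bracket (e_mat i j a) (e_mat k l b) =
    (if j = k then e_mat i l (a * b) else 0) - (if l = i then e_mat k j (b * a) else 0)"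
  by (simp add: lie_bracket_def e_mat_mult)

section \<open>Sums of sets\<close>

text \<open>Additive closure is enough to bound the Minkowski sums in \<open>f_diff\<close>,
  \<open>Delta\<close> and \<open>g_under\<close>, and it spares any bookkeeping of scalars.\<close>

definition add_closed :: "'a::comm_monoid_add set \<Rightarrow> bool" where
  "add_closed S \<longleftrightarrow> 0 \<in> S \<and> (\<forall>x\<in>S. \<forall>y\<in>S. x + y \<in> S)"

lemma add_closed_zero: "add_closed S \<Longrightarrow> 0 \<in> S"
  by (simp add: add_closed_def)

lemma add_closed_plus: "add_closed S \<Longrightarrow> add_closed T \<Longrightarrow> add_closed (S + T)"
  unfolding add_closed_def set_plus_def
  by (clarsimp, intro conjI) (metis add_0, metis add.assoc add.left_commute)

lemma add_closed_sum: "(\<And>i. i \<in> I \<Longrightarrow> add_closed (S i)) \<Longrightarrow> add_closed (\<Sum>i\<in>I. S i)"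
proof (induction I rule: infinite_finite_induct)
  case (insert i I)
  then show ?case by (simp add: add_closed_plus)
qed (simp_all add: add_closed_def)

lemma add_closed_image:
  assumes "add_closed S" "f 0 = 0" "\<And>x y. f (x + y) = f x + f y"
  shows "add_closed (f ` S)"
  using assms unfolding add_closed_def by (auto simp: assms(3)[symmetric])

lemma add_closed_sum_mem:
  "add_closed S \<Longrightarrow> (\<And>i. i \<in> I \<Longrightarrow> f i \<in> S) \<Longrightarrow> (\<Sum>i\<in>I. f i) \<in> S"
  by (induction I rule: infinite_finite_induct) (auto simp: add_closed_def)

lemma sum_mem_set_sum: "finite I \<Longrightarrow> (\<And>i. i \<in> I \<Longrightarrow> f i \<in> S i) \<Longrightarrow> (\<Sum>i\<in>I. f i) \<in> (\<Sum>i\<in>I. S i)"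
  by (auto simp: set_sum_alt)

lemma mem_set_sum:
  assumes "finite I" "i \<in> I" "x \<in> S i" "\<And>j. j \<in> I \<Longrightarrow> 0 \<in> S j"
  shows "x \<in> (\<Sum>i\<in>I. S i)"
proof -
  have "(\<Sum>j\<in>I. if j = i then x else 0) \<in> (\<Sum>i\<in>I. S i)"
    using assms by (intro sum_mem_set_sum) auto
  then show ?thesis using assms by simp
qed

lemma set_plus_subset: "add_closed T \<Longrightarrow> A \<subseteq> T \<Longrightarrow> B \<subseteq> T \<Longrightarrow> A + B \<subseteq> T"
  by (auto simp: set_plus_def add_closed_def subset_eq)

lemma set_sum_subset:
  assumes "add_closed T" "finite I" "\<And>i. i \<in> I \<Longrightarrow> S i \<subseteq> T"
  shows "(\<Sum>i\<in>I. S i) \<subseteq> T"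
  using assms by (auto simp: set_sum_alt intro!: add_closed_sum_mem)

section \<open>Involutive algebras\<close>

context involutive_algebra
begin

lemma smul_mult [simp]: "smul c a * b = smul c (a * b)" "a * smul c b = smul c (a * b)"
  by (simp_all add: smul_mult_left smul_mult_right[symmetric])

lemma bar_add [simp]: "bar (a + b) = bar a + bar b"
  and bar_smul [simp]: "bar (smul c a) = smul c (bar a)"
  using bar_linear by (auto simp: Vector_Spaces.linear_iff)

lemma bar_0 [simp]: "bar 0 = 0"
  using bar_add[of 0 0] by simp

lemma bar_minus [simp]: "bar (- a) = - bar a"
  using bar_add[of a "- a"] by (simp add: eq_neg_iff_add_eq_0 add.commute)

lemma bar_diff [simp]: "bar (a - b) = bar a - bar b"
  using bar_add[of a "- b"] by simp

lemma bar_sum: "bar (\<Sum>i\<in>I. a i) = (\<Sum>i\<in>I. bar (a i))"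
  by (induction I rule: infinite_finite_induct) simp_all

lemma bar_one [simp]: "bar 1 = 1"
  by (metis bar_bar bar_mult mult_1_left mult_1_right)

declare bar_bar [simp] bar_mult [simp]

lemma image_bar_eq:
  assumes "\<And>a. a \<in> S \<Longrightarrow> bar a \<in> S"
  shows "bar ` S = S"
  using assms by (metis bar_bar image_eqI image_subsetI subsetI subset_antisym)

lemma smul_half_double [simp]: "smul (1/2) (a + a) = a" "smul (1/2) a + smul (1/2) a = a"
  using scale_left_distrib[of "1/2" "1/2" a] by (simp_all add: scale_right_distrib)

lemma double_eq_0: "a + a = (0::'r) \<Longrightarrow> a = 0"
  using smul_half_double(1)[of a] by simp

lemma mscale_nth [simp]: "mscale smul c x $ p $ q = smul c (x $ p $ q)"
  by (simp add: mscale_def)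

lemma vector_space_mscale:
  "vector_space (mscale smul :: 'k \<Rightarrow> ('r, 'n::finite) gl2n \<Rightarrow> ('r, 'n) gl2n)"
  by unfold_locales (simp_all add: vec_eq_iff scale_right_distrib scale_left_distrib)

lemma mscale_half_double [simp]: "mscale smul (1/2) (x + x) = x"
  by (simp add: vec_eq_iff)

lemma mscale_diff: "mscale smul c (x - y) = mscale smul c x - mscale smul c y"
  by (simp add: vec_eq_iff scale_right_diff_distrib)

lemma mscale_e_mat: "mscale smul c (e_mat p q a) = e_mat p q (smul c a)"
  by (simp add: vec_eq_iff)

lemma lie_bracket_mscale_right: "lie_bracket x (mscale smul c y) = mscale smul c (lie_bracket x y)"
  by (simp add: vec_eq_iff lie_bracket_nth scale_sum_right scale_right_diff_distrib)

lemma subspace_comm_span: "subspace (comm_span smul A B)"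
  by (simp add: comm_span_def)

lemma commutator_in_comm_span: "a \<in> A \<Longrightarrow> b \<in> B \<Longrightarrow> a * b - b * a \<in> comm_span smul A B"
  unfolding comm_span_def by (rule span_base) auto

lemma bar_comm_span_UNIV:
  assumes "a \<in> comm_span smul UNIV UNIV"
  shows "bar a \<in> comm_span smul UNIV UNIV"
  using assms unfolding comm_span_def
proof (induction rule: span_induct_alt)
  case base
  then show ?case by (simp add: span_zero)
next
  case (step c x y)
  from step.hyps obtain a b where "x = a * b - b * a" by auto
  then have "bar x = bar b * bar a - bar a * bar b" by simp
  then have "bar x \<in> span {a * b - b * a |a b. a \<in> UNIV \<and> b \<in> UNIV}"
    by (auto intro!: span_base)
  then show ?case using step.IH by (simp add: span_add span_scale)
qed

text \<open>The symmetric half of \<open>a\<close> is always in R_+, so only the skew half is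
  constrained. The right-hand side has the shape of the trace of \<open>f_mat bar i i a\<close>,
  which is how the condition is later obtained.\<close>

lemma mem_sym_plus_comm_iff:
  "a \<in> bar_eigenspace smul bar 1 + comm_span smul UNIV UNIV \<longleftrightarrow>
    a - bar a \<in> comm_span smul UNIV UNIV" (is "_ \<longleftrightarrow> _ \<in> ?C")
proof
  assume "a \<in> bar_eigenspace smul bar 1 + ?C"
  then obtain b c where a: "a = b + c" "bar b = b" "c \<in> ?C"
    by (auto simp: set_plus_def bar_eigenspace_def)
  then have "a - bar a = c - bar c" by simp
  then show "a - bar a \<in> ?C"
    using a(3) bar_comm_span_UNIV subspace_diff[OF subspace_comm_span] by metis
next
  assume C: "a - bar a \<in> ?C"
  have "a = smul (1/2) (a + bar a) + smul (1/2) (a - bar a)"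
    by (simp add: scale_right_distrib scale_right_diff_distrib)
  moreover have "smul (1/2) (a + bar a) \<in> bar_eigenspace smul bar 1"
    by (simp add: bar_eigenspace_def add.commute)
  moreover have "smul (1/2) (a - bar a) \<in> ?C"
    using C subspace_scale[OF subspace_comm_span] by blast
  ultimately show "a \<in> bar_eigenspace smul bar 1 + ?C" by (metis set_plus_intro)
qed

end

section \<open>Brackets of the generators\<close>

text \<open>Each generator is supported on a position \<open>(p, q)\<close> and its partner
  \<open>(opp q, opp p)\<close>; on weights, \<open>opp\<close> acts as negation.\<close>

fun opp :: "'n + 'n \<Rightarrow> 'n + 'n" where
  "opp (Inl i) = Inr i"
| "opp (Inr i) = Inl i"

lemma opp_opp [simp]: "opp (opp p) = p"
  by (cases p) simp_all

lemma bij_opp: "bij opp"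
  by (rule involuntory_imp_bij) simp

locale split_involutive_algebra = involutive_algebra smul bar
  for smul :: "'k::field_char_0 \<Rightarrow> 'r::ring_1 \<Rightarrow> 'r" and bar :: "'r \<Rightarrow> 'r" +
  fixes \<rho> :: 'k
  assumes rho: "\<rho> \<in> {1, -1}"
begin

abbreviation F :: "'n \<Rightarrow> 'n \<Rightarrow> 'r \<Rightarrow> ('r, 'n::finite) gl2n" where "F \<equiv> f_mat bar"
abbreviation G :: "'n \<Rightarrow> 'n \<Rightarrow> 'r \<Rightarrow> ('r, 'n::finite) gl2n" where "G \<equiv> g_mat smul bar \<rho>"
abbreviation H :: "'n \<Rightarrow> 'n \<Rightarrow> 'r \<Rightarrow> ('r, 'n::finite) gl2n" where "H \<equiv> h_mat smul bar \<rho>"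

lemma rho_square [simp]: "\<rho> * \<rho> = 1"
  using rho by auto

lemma G_eq: "G i j a = e_mat (Inl i) (Inr j) a - e_mat (Inl j) (Inr i) (smul \<rho> (bar a))"
  by (simp add: g_mat_def mscale_e_mat)

lemma H_eq: "H i j a = e_mat (Inr i) (Inl j) a - e_mat (Inr j) (Inl i) (smul \<rho> (bar a))"
  by (simp add: h_mat_def mscale_e_mat)

lemma FGH_add:
  "F i j (a + b) = F i j a + F i j b"
  "G i j (a + b) = G i j a + G i j b"
  "H i j (a + b) = H i j a + H i j b"
  by (simp_all add: f_mat_def G_eq H_eq scale_right_distrib e_mat_add)

lemma FGH_smul:
  "F i j (smul c a) = mscale smul c (F i j a)"
  "G i j (smul c a) = mscale smul c (G i j a)"
  "H i j (smul c a) = mscale smul c (H i j a)"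
  by (simp_all add: f_mat_def G_eq H_eq mscale_diff mscale_e_mat mult.commute[of c])

lemma FGH_diff:
  "F i j (a - b) = F i j a - F i j b"
  "G i j (a - b) = G i j a - G i j b"
  "H i j (a - b) = H i j a - H i j b"
  by (simp_all add: f_mat_def G_eq H_eq scale_right_diff_distrib e_mat_diff)

lemma FGH_0 [simp]: "F i j 0 = 0" "G i j 0 = 0" "H i j 0 = 0"
  by (simp_all add: f_mat_def G_eq H_eq)

lemma F_sum: "F i j (\<Sum>k\<in>K. a k) = (\<Sum>k\<in>K. F i j (a k))"
  by (induction K rule: infinite_finite_induct) (simp_all add: FGH_add)

lemma trace_FF: "(\<Sum>p\<in>UNIV. F i i a $ p $ p) = a - bar a"
  by (simp add: f_mat_def sum_subtractf)

lemma G_swap: "G j i a = mscale smul (- \<rho>) (G i j (bar a))"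
  by (simp add: G_eq mscale_diff mscale_e_mat e_mat_minus)

lemma H_swap: "H j i a = mscale smul (- \<rho>) (H i j (bar a))"
  by (simp add: H_eq mscale_diff mscale_e_mat e_mat_minus)

lemmas bracket_expand = f_mat_def G_eq H_eq lie_bracket_diff_left lie_bracket_diff_right
  lie_bracket_e_mat e_mat_minus

lemma bracket_FF:
  "lie_bracket (F i j a) (F k l b) =
    (if j = k then F i l (a * b) else 0) - (if i = l then F k j (b * a) else 0)"
  by (auto simp: bracket_expand)

lemma bracket_FG:
  "lie_bracket (F i j a) (G k l b) =
    (if j = k then G i l (a * b) else 0) + (if j = l then G k i (b * bar a) else 0)"
  by (auto simp: bracket_expand)

lemma bracket_FH:
  "lie_bracket (F i j a) (H k l b) =
    - (if i = k then H j l (bar a * b) else 0) - (if i = l then H k j (b * a) else 0)"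
  by (auto simp: bracket_expand)

text \<open>Excluding \<open>i = j\<close> and \<open>j = l\<close> leaves at most two products. For
  \<open>i = l\<close> the diagonal terms come with a plus sign, whereas \<open>bracket_FF\<close>
  gives a difference; adding the two isolates one diagonal entry.\<close>

lemma bracket_GH:
  assumes "i \<noteq> j" "j \<noteq> l"
  shows "lie_bracket (G i j a) (H j l b) = F i l (a * b) + (if i = l then F j j (bar a * bar b) else 0)"
  using assms by (auto simp: bracket_expand)

section \<open>The Lie algebra generated by the root vectors\<close>

definition pos_sign :: "'n + 'n \<Rightarrow> 'n + 'n \<Rightarrow> 'k" where
  "pos_sign p q = (if isl p = isl q then 1 else \<rho>)"

text \<open>In 2 x 2 blocks this says that x equals minus its adjoint for the form with rows (0, 1)
  and (\<rho>, 0); \<open>pos_sign\<close> records the factor \<rho> on the off-diagonal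
  blocks.\<close>

definition skew :: "('r, 'n::finite) gl2n \<Rightarrow> bool" where
  "skew x \<longleftrightarrow> (\<forall>p q. x $ opp q $ opp p = - smul (pos_sign p q) (bar (x $ p $ q)))"

text \<open>The adjoint is an involution, so any matrix minus its adjoint is skew. Every generator
  has this form.\<close>

lemma skew_e_mat:
  "skew (e_mat p q a - e_mat (opp q) (opp p) (smul (pos_sign p q) (bar a)))"
  unfolding skew_def
proof (intro allI)
  fix r s
  have opp: "opp s = p \<and> opp r = q \<longleftrightarrow> r = opp q \<and> s = opp p"
    "opp s = opp q \<and> opp r = opp p \<longleftrightarrow> r = p \<and> s = q"
    by (metis opp_opp)+
  have sgn: "pos_sign (opp q) (opp p) = pos_sign p q" "pos_sign p q * pos_sign p q = 1"
    by (cases p; cases q; simp add: pos_sign_def)+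
  \<comment> \<open>\<open>P\<close> and \<open>Q\<close> hold together when
    \<open>q = opp p\<close>, the long root case, so all four combinations have to be
    treated.\<close>
  define P Q where PQ: "P \<longleftrightarrow> r = p \<and> s = q" "Q \<longleftrightarrow> r = opp q \<and> s = opp p"
  have "P \<or> Q \<Longrightarrow> pos_sign r s = pos_sign p q"
    using sgn by (auto simp: PQ)
  then show "(e_mat p q a - e_mat (opp q) (opp p) (smul (pos_sign p q) (bar a))) $ opp s $ opp r =
    - smul (pos_sign r s)
      (bar ((e_mat p q a - e_mat (opp q) (opp p) (smul (pos_sign p q) (bar a))) $ r $ s))"
    unfolding e_mat_nth vector_minus_component opp PQ[symmetric]
    by (cases P; cases Q) (simp_all add: sgn scale_right_diff_distrib)
qed

lemma skew_FGH: "skew (F i j a)" "skew (G i j a)" "skew (H i j a)"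
  using skew_e_mat[of "Inl i" "Inl j" a] skew_e_mat[of "Inl i" "Inr j" a]
    skew_e_mat[of "Inr i" "Inl j" a]
  by (simp_all add: f_mat_def G_eq H_eq pos_sign_def)

text \<open>This cocycle identity makes the entrywise adjoint reverse matrix products.\<close>

lemma pos_sign_mult: "pos_sign p r * pos_sign r q = pos_sign p q"
  by (auto simp: pos_sign_def)

lemma skew_bracket:
  fixes x y :: "('r, 'n::finite) gl2n"
  assumes "skew x" "skew y"
  shows "skew (lie_bracket x y)"
  unfolding skew_def
proof (intro allI)
  fix p q :: "'n + 'n"
  \<comment> \<open>The two minus signs from the skewness of \<open>u\<close> and \<open>v\<close>
    cancel, so the product is reversed without a sign; reversing the commutator then supplies the
    one that is required.\<close>
  have *: "u $ opp q $ opp r * v $ opp r $ opp p = smul (pos_sign p q) (bar (v $ p $ r * u $ r $ q))"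
    if "skew u" "skew v" for u v :: "('r, 'n) gl2n" and r
    using that by (simp add: skew_def pos_sign_mult mult.commute[of "pos_sign r q"])
  have "lie_bracket x y $ opp q $ opp p =
      (\<Sum>r\<in>UNIV. x $ opp q $ opp r * y $ opp r $ opp p - y $ opp q $ opp r * x $ opp r $ opp p)"
    unfolding lie_bracket_nth by (rule sum.reindex_bij_betw[OF bij_opp, symmetric])
  also have "\<dots> = (\<Sum>r\<in>UNIV. smul (pos_sign p q) (bar (y $ p $ r * x $ r $ q - x $ p $ r * y $ r $ q)))"
    by (simp only: * assms bar_diff scale_right_diff_distrib)
  also have "\<dots> = smul (pos_sign p q) (bar (lie_bracket y x $ p $ q))"
    by (simp only: lie_bracket_nth bar_sum scale_sum_right)
  also have "\<dots> = - smul (pos_sign p q) (bar (lie_bracket x y $ p $ q))"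
    by (subst lie_bracket_swap) simp
  finally show "lie_bracket x y $ opp q $ opp p = - smul (pos_sign p q) (bar (lie_bracket x y $ p $ q))" .
qed

text \<open>Over a noncommutative ring the traces of \<open>x ** y\<close> and \<open>y ** x\<close>
  differ; after exchanging the summations in one of them, the difference is a sum of ring
  commutators.\<close>

lemma trace_bracket: "(\<Sum>p\<in>UNIV. lie_bracket x y $ p $ p) \<in> comm_span smul UNIV UNIV"
proof -
  have "(\<Sum>p\<in>UNIV. lie_bracket x y $ p $ p) =
      (\<Sum>p\<in>UNIV. \<Sum>r\<in>UNIV. x $ p $ r * y $ r $ p) - (\<Sum>p\<in>UNIV. \<Sum>r\<in>UNIV. y $ p $ r * x $ r $ p)"
    by (simp add: lie_bracket_nth sum_subtractf)
  also have "(\<Sum>p\<in>UNIV. \<Sum>r\<in>UNIV. y $ p $ r * x $ r $ p) = (\<Sum>p\<in>UNIV. \<Sum>r\<in>UNIV. y $ r $ p * x $ p $ r)"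
    by (rule sum.swap)
  finally have "(\<Sum>p\<in>UNIV. lie_bracket x y $ p $ p) =
      (\<Sum>p\<in>UNIV. \<Sum>r\<in>UNIV. x $ p $ r * y $ r $ p - y $ r $ p * x $ p $ r)"
    by (simp add: sum_subtractf)
  then show ?thesis
    by (simp add: subspace_sum[OF subspace_comm_span] commutator_in_comm_span)
qed

text \<open>For skew \<open>x\<close> with upper left block \<open>A\<close>, the full trace of \<open>x\<close> is \<open>tr A - bar (tr A)\<close>. So
  the trace condition below says that \<open>tr A\<close> lies in \<open>R\<^sub>+ + [R, R]\<close>.\<close>

lemma lie_g_subset:
  assumes "x \<in> (lie_g smul bar \<rho> :: ('r, 'n::{finite,linorder}) gl2n set)"
  shows "skew x" "(\<Sum>p\<in>UNIV. x $ p $ p) \<in> comm_span smul UNIV UNIV"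
proof -
  interpret M: vector_space "mscale smul :: 'k \<Rightarrow> ('r, 'n) gl2n \<Rightarrow> ('r, 'n) gl2n"
    by (rule vector_space_mscale)
  let ?C = "comm_span smul UNIV UNIV :: 'r set"
  let ?L = "{x :: ('r, 'n) gl2n. skew x \<and> (\<Sum>p\<in>UNIV. x $ p $ p) \<in> ?C}"
  have "lie_subalgebra smul ?L"
    unfolding lie_subalgebra_def
  proof
    show "M.subspace ?L"
      using subspace_comm_span[of UNIV UNIV]
      by (auto simp: M.subspace_def subspace_def skew_def scale_right_distrib sum.distrib
          scale_sum_right[symmetric] mult.commute)
    show "\<forall>x\<in>?L. \<forall>y\<in>?L. lie_bracket x y \<in> ?L"
      by (simp add: skew_bracket trace_bracket)
  qed
  moreover have "F i j a \<in> ?L" if "i \<noteq> j" for i j a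
  proof -
    have "F i j a $ p $ p = 0" for p using that by (auto simp: f_mat_def)
    then show ?thesis using subspace_0[OF subspace_comm_span] by (simp add: skew_FGH)
  qed
  moreover have "G i j a \<in> ?L" "H i j a \<in> ?L" for i j a
  proof -
    have "G i j a $ p $ p = 0" "H i j a $ p $ p = 0" for p by (auto simp: G_eq H_eq)
    then show "G i j a \<in> ?L" "H i j a \<in> ?L"
      using subspace_0[OF subspace_comm_span] by (simp_all add: skew_FGH)
  qed
  ultimately have "lie_g smul bar \<rho> \<subseteq> ?L"
    unfolding lie_g_def by (intro hull_minimal) auto
  with assms show "skew x" "(\<Sum>p\<in>UNIV. x $ p $ p) \<in> ?C" by auto
qed

lemma lie_subalgebra_lie_g:
  "lie_subalgebra smul (lie_g smul bar \<rho> :: ('r, 'n::{finite,linorder}) gl2n set)"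
  unfolding lie_g_def
proof (rule hull_in)
  interpret M: vector_space "mscale smul :: 'k \<Rightarrow> ('r, 'n) gl2n \<Rightarrow> ('r, 'n) gl2n"
    by (rule vector_space_mscale)
  fix T :: "('r, 'n) gl2n set set"
  assume "Ball T (lie_subalgebra smul)"
  then show "lie_subalgebra smul (\<Inter>T)"
    by (auto simp: lie_subalgebra_def M.subspace_def)
qed

text \<open>The generating set has g and h only for \<open>i \<le> j\<close>; the swap identities
  supply the other order up to a scalar.\<close>

lemma FGH_in_lie_g:
  "i \<noteq> j \<Longrightarrow> F i j a \<in> (lie_g smul bar \<rho> :: ('r, 'n::{finite,linorder}) gl2n set)"
  "G i j a \<in> (lie_g smul bar \<rho> :: ('r, 'n) gl2n set)"
  "H i j a \<in> (lie_g smul bar \<rho> :: ('r, 'n) gl2n set)"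
proof -
  interpret M: vector_space "mscale smul :: 'k \<Rightarrow> ('r, 'n) gl2n \<Rightarrow> ('r, 'n) gl2n"
    by (rule vector_space_mscale)
  have sub: "M.subspace (lie_g smul bar \<rho>)"
    using lie_subalgebra_lie_g by (auto simp: lie_subalgebra_def)
  show "F i j a \<in> lie_g smul bar \<rho>" if "i \<noteq> j"
    unfolding lie_g_def by (intro hull_inc UnI1 CollectI exI[of _ i] exI[of _ j] exI[of _ a] conjI refl that)
  have G: "G i j a \<in> lie_g smul bar \<rho>" if "i \<le> j" for i j :: 'n and a
    unfolding lie_g_def using that by (intro hull_inc UnI1 UnI2 CollectI) blast
  then show "G i j a \<in> lie_g smul bar \<rho>"
    using M.subspace_scale[OF sub] by (metis linear G_swap)
  have H: "H i j a \<in> lie_g smul bar \<rho>" if "i \<le> j" for i j :: 'n and a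
    unfolding lie_g_def using that by (intro hull_inc UnI2 CollectI) blast
  then show "H i j a \<in> lie_g smul bar \<rho>"
    using M.subspace_scale[OF sub] by (metis linear H_swap)
qed

section \<open>Weights of the Cartan subalgebra\<close>

text \<open>The scalar that \<open>cartan_elt smul a\<close> carries at the diagonal place
  \<open>p\<close>.\<close>

definition wt :: "('n \<Rightarrow> 'k) \<Rightarrow> 'n + 'n \<Rightarrow> 'k" where
  "wt a p = (case p of Inl i \<Rightarrow> a i | Inr i \<Rightarrow> - a i)"

lemma wt_simps [simp]: "wt a (Inl i) = a i" "wt a (Inr i) = - a i"
  by (simp_all add: wt_def)

lemma wt_opp [simp]: "wt a (opp p) = - wt a p"
  by (cases p) simp_all

lemma wt_separating: "\<exists>a. \<forall>q. wt a q = (if q = p then 1 else if q = opp p then - 1 else 0)"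
proof (cases p)
  case (Inl i)
  then show ?thesis
    by (intro exI[of _ "\<lambda>j. if j = i then 1 else 0"]) (simp add: split_sum_all)
next
  case (Inr i)
  then show ?thesis
    by (intro exI[of _ "\<lambda>j. if j = i then - 1 else 0"]) (simp add: split_sum_all)
qed

lemma opp_neq [simp]: "opp p \<noteq> p" "p \<noteq> opp p"
  by (cases p; simp)+

lemma wt_eqD:
  assumes "\<And>a. wt a p = wt a q"
  shows "p = q"
proof -
  obtain a where a: "\<And>q. wt a q = (if q = p then 1 else if q = opp p then - 1 else 0)"
    using wt_separating by blast
  have "wt a q = 1" using assms[of a] a[of p] by simp
  then show ?thesis using a[of q] by (simp split: if_splits)
qed

text \<open>Evaluate at the parameter that is 1 at \<open>w\<close>, -1 at \<open>opp w\<close> and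
  0 elsewhere. The right side is 1 or 2 because \<open>t\<close> is not \<open>opp w\<close>, while
  positions other than \<open>w\<close> contribute 0 or -1 on the left. Hence \<open>w\<close>
  occurs on the left and can be cancelled.\<close>

lemma wt_add_eqD:
  assumes eq: "\<And>a. wt a u + wt a v = wt a w + wt a t" and "t \<noteq> opp w"
  shows "u = w \<and> v = t \<or> u = t \<and> v = w"
proof -
  obtain a where a: "\<And>q. wt a q = (if q = w then 1 else if q = opp w then - 1 else 0)"
    using wt_separating by blast
  have "wt a t = 0 \<or> wt a t = 1" using a[of t] assms(2) by auto
  then have "wt a u + wt a v = 1 \<or> wt a u + wt a v = 2"
    using eq[of a] a[of w] by auto
  moreover have "wt a q = 0 \<or> wt a q = - 1" if "q \<noteq> w" for q
    using a[of q] that by auto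
  \<comment> \<open>The possible sums are 0, -1 and -2; characteristic 0 keeps them apart from 1 and
    2.\<close>
  moreover have "c + d \<noteq> 1 \<and> c + d \<noteq> 2" if "c = 0 \<or> c = - 1" "d = 0 \<or> d = - 1" for c d :: 'k
    using that by auto
  ultimately have "u = w \<or> v = w" by blast
  then show ?thesis
  proof
    assume "u = w"
    then have "v = t" using eq by (intro wt_eqD) simp
    with \<open>u = w\<close> show ?thesis by simp
  next
    assume "v = w"
    then have "u = t" using eq by (intro wt_eqD) (metis add.commute add_left_cancel)
    with \<open>v = w\<close> show ?thesis by simp
  qed
qed

lemma cartan_elt_nth:
  "cartan_elt smul a $ p $ q = (if p = q then smul (wt a p) 1 else 0)"
proof (cases p)
  case (Inl i)
  have "cartan_elt smul a $ p $ q = (\<Sum>k\<in>UNIV. if k = i then (if p = q then smul (wt a p) 1 else 0) else 0)"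
    unfolding cartan_elt_def sum_component
    by (rule sum.cong) (auto simp: Inl)
  then show ?thesis by simp
next
  case (Inr i)
  have "cartan_elt smul a $ p $ q = (\<Sum>k\<in>UNIV. if k = i then (if p = q then smul (wt a p) 1 else 0) else 0)"
    unfolding cartan_elt_def sum_component
    by (rule sum.cong) (auto simp: Inr)
  then show ?thesis by simp
qed

text \<open>This makes \<open>inv (cartan_elt smul)\<close> in \<open>eps\<close> a genuine
  coordinate map; it rests on 1 being nonzero in R.\<close>

lemma inj_cartan_elt: "inj (cartan_elt smul :: ('n::finite \<Rightarrow> 'k) \<Rightarrow> ('r, 'n) gl2n)"
proof (rule injI, rule ext)
  fix a b :: "'n \<Rightarrow> 'k" and i
  assume "(cartan_elt smul a :: ('r, 'n) gl2n) = cartan_elt smul b"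
  then have "(cartan_elt smul a :: ('r, 'n) gl2n) $ Inl i $ Inl i = cartan_elt smul b $ Inl i $ Inl i"
    by simp
  then have "smul (a i) (1::'r) = smul (b i) 1" by (simp add: cartan_elt_nth)
  then show "a i = b i" by simp
qed

lemma bracket_cartan_elt:
  "lie_bracket (cartan_elt smul a) x $ p $ q = smul (wt a p - wt a q) (x $ p $ q)"
proof -
  have "lie_bracket (cartan_elt smul a) x $ p $ q =
      (\<Sum>r\<in>UNIV. if r = p then smul (wt a p) (x $ p $ q) else 0) -
      (\<Sum>r\<in>UNIV. if r = q then smul (wt a q) (x $ p $ q) else 0)"
    unfolding lie_bracket_nth sum_subtractf
    by (intro arg_cong2[where f = "(-)"] sum.cong) (auto simp: cartan_elt_nth)
  then show ?thesis by (simp add: scale_left_diff_distrib)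
qed

definition rt :: "'n + 'n \<Rightarrow> 'n + 'n \<Rightarrow> ('r, 'n::finite) gl2n \<Rightarrow> 'k" where
  "rt p q = (\<lambda>h. wt (\<lambda>i. eps smul i h) p - wt (\<lambda>i. eps smul i h) q)"

lemma rt_cartan_elt [simp]: "rt p q (cartan_elt smul a) = wt a p - wt a q"
  by (simp add: rt_def eps_def inj_cartan_elt inv_f_f)

text \<open>Weights are functions on all matrices, so agreement must be extended off the Cartan
  subalgebra. \<open>eps\<close> sees \<open>h\<close> only through its inverse image, and
  \<open>?h\<close> is a Cartan element with the same coordinates.\<close>

lemma rt_eq_on_cartan:
  fixes p q r s :: "'n::finite + 'n"
  assumes "\<And>h. h \<in> (cartan smul :: ('r, 'n) gl2n set) \<Longrightarrow> rt p q h = rt r s h"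
  shows "(rt p q :: ('r, 'n) gl2n \<Rightarrow> 'k) = rt r s"
proof
  fix h :: "('r, 'n) gl2n"
  let ?h = "cartan_elt smul (inv (cartan_elt smul) h) :: ('r, 'n) gl2n"
  have "eps smul i ?h = eps smul i h" for i
    by (simp add: eps_def inj_cartan_elt inv_f_f)
  then have "rt u v h = rt u v ?h" for u v by (simp add: rt_def)
  then show "rt p q h = rt r s h" using assms[of ?h] by (simp add: cartan_def)
qed

lemma rt_self [simp]: "rt p p = (\<lambda>h. 0)"
  by (simp add: rt_def)

lemma zero_in_range_rt: "(\<lambda>h. 0) \<in> range (\<lambda>(p, q). rt p q)"
  by (rule image_eqI[of _ _ "(p, p)" for p]) simp_all

lemma rt_opp: "rt (opp q) (opp p) = rt p q"
  by (simp add: rt_def)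

text \<open>Moving the negative terms across with \<open>opp\<close> turns equality of differences
  into equality of sums, the form handled by \<open>wt_add_eqD\<close>.\<close>

lemma rt_eq_iff:
  fixes p q r s :: "'n::finite + 'n"
  assumes "p \<noteq> q"
  shows "(rt r s :: ('r, 'n) gl2n \<Rightarrow> 'k) = rt p q \<longleftrightarrow> r = p \<and> s = q \<or> r = opp q \<and> s = opp p"
proof
  assume eq: "(rt r s :: ('r, 'n) gl2n \<Rightarrow> 'k) = rt p q"
  have "wt a r + wt a (opp s) = wt a p + wt a (opp q)" for a
    using fun_cong[OF eq, of "cartan_elt smul a"] by simp
  moreover have "opp q \<noteq> opp p" using assms by (metis opp_opp)
  ultimately have "r = p \<and> opp s = opp q \<or> r = opp q \<and> opp s = p"
    by (rule wt_add_eqD)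
  then show "r = p \<and> s = q \<or> r = opp q \<and> s = opp p" by (metis opp_opp)
qed (auto simp: rt_opp)

lemma rt_eq_0_iff:
  fixes p q :: "'n::finite + 'n"
  shows "(rt p q :: ('r, 'n) gl2n \<Rightarrow> 'k) = (\<lambda>h. 0) \<longleftrightarrow> p = q"
proof
  assume eq: "(rt p q :: ('r, 'n) gl2n \<Rightarrow> 'k) = (\<lambda>h. 0)"
  show "p = q"
  proof (rule wt_eqD)
    show "wt a p = wt a q" for a
      using fun_cong[OF eq, of "cartan_elt smul a"] by simp
  qed
qed simp

text \<open>Indexing roots by off-diagonal positions replaces five families by one and matches
  matrix entries directly.\<close>

lemma roots_C_eq:
  "roots_C smul = {rt p q :: ('r, 'n::{finite,linorder}) gl2n \<Rightarrow> 'k |p q. p \<noteq> q}"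
  (is "_ = ?R")
proof
  show "roots_C smul \<subseteq> ?R"
    unfolding roots_C_def
  proof (intro Un_least subsetI; clarsimp)
    fix i j :: 'n
    show "\<exists>p q. (\<lambda>h. eps smul i h - eps smul j h) = rt p q \<and> p \<noteq> q" if "i \<noteq> j"
      using that by (intro exI[of _ "Inl i"] exI[of _ "Inl j"]) (simp add: rt_def)
    show "\<exists>p q. (\<lambda>h. eps smul i h + eps smul j h) = rt p q \<and> p \<noteq> q"
      by (intro exI[of _ "Inl i"] exI[of _ "Inr j"]) (simp add: rt_def)
    show "\<exists>p q. (\<lambda>h. - eps smul j h - eps smul i h) = rt p q \<and> p \<noteq> q"
      by (intro exI[of _ "Inr j"] exI[of _ "Inl i"]) (simp add: rt_def)
    show "\<exists>p q. (\<lambda>h. 2 * eps smul i h) = rt p q \<and> p \<noteq> q"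
      by (intro exI[of _ "Inl i"] exI[of _ "Inr i"]) (simp add: rt_def)
    show "\<exists>p q. (\<lambda>h. - (2 * eps smul i h)) = rt p q \<and> p \<noteq> q"
      by (intro exI[of _ "Inr i"] exI[of _ "Inl i"]) (simp add: rt_def)
  qed
  show "?R \<subseteq> roots_C smul"
  proof
    fix \<alpha> assume "\<alpha> \<in> ?R"
    then obtain p q :: "'n + 'n" where \<alpha>: "\<alpha> = rt p q" and "p \<noteq> q" by blast
    have eqs: "rt (Inl i) (Inl j) = (\<lambda>h :: ('r, 'n) gl2n. eps smul i h - eps smul j h)"
      "rt (Inl i) (Inr j) = (\<lambda>h :: ('r, 'n) gl2n. eps smul i h + eps smul j h)"
      "rt (Inr i) (Inl j) = (\<lambda>h :: ('r, 'n) gl2n. - (eps smul i h + eps smul j h))"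
      "rt (Inl i) (Inr i) = (\<lambda>h :: ('r, 'n) gl2n. 2 * eps smul i h)"
      "rt (Inr i) (Inl i) = (\<lambda>h :: ('r, 'n) gl2n. - (2 * eps smul i h))" for i j
      by (simp_all add: rt_def)
    have ff: "rt (Inl i) (Inl j) \<in> roots_C smul" if "i \<noteq> j" for i j :: 'n
      unfolding roots_C_def using that eqs(1)[of i j] by blast
    have lt: "rt (Inl i) (Inr j) \<in> roots_C smul" "rt (Inr i) (Inl j) \<in> roots_C smul" if "i < j" for i j :: 'n
      unfolding roots_C_def using that eqs(2,3)[of i j] by blast+
    have eq: "rt (Inl i) (Inr i) \<in> roots_C smul" "rt (Inr i) (Inl i) \<in> roots_C smul" for i :: 'n
      unfolding roots_C_def using eqs(4,5)[of i] by blast+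
    have swap: "rt (Inl i) (Inr j) = rt (Inl j) (Inr i)" "rt (Inr i) (Inl j) = rt (Inr j) (Inl i)"
      "rt (Inr i) (Inr j) = rt (Inl j) (Inl i)" for i j :: 'n
      by (simp_all add: rt_def add.commute fun_eq_iff)
    have g: "rt (Inl i) (Inr j) \<in> roots_C smul" "rt (Inr i) (Inl j) \<in> roots_C smul" for i j :: 'n
      using lt eq swap by (metis linorder_neqE)+
    show "\<alpha> \<in> roots_C smul"
      unfolding \<alpha> using \<open>p \<noteq> q\<close> ff g swap(3) by (cases p; cases q) auto
  qed
qed

text \<open>Matrices of weight \<open>\<alpha>\<close> are those supported on the positions \<open>(p, q)\<close> with \<open>rt p q = \<alpha>\<close>.\<close>

definition component :: "(('r, 'n::finite) gl2n \<Rightarrow> 'k) \<Rightarrow> ('r, 'n) gl2n \<Rightarrow> ('r, 'n) gl2n" where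
  "component \<alpha> x = (\<chi> p q. if rt p q = \<alpha> then x $ p $ q else 0)"

definition has_weight :: "(('r, 'n::finite) gl2n \<Rightarrow> 'k) \<Rightarrow> ('r, 'n) gl2n \<Rightarrow> bool" where
  "has_weight \<alpha> x \<longleftrightarrow> (\<forall>h\<in>cartan smul. lie_bracket h x = mscale smul (\<alpha> h) x)"

lemma has_weight_component: "has_weight \<alpha> (component \<alpha> x)"
  by (auto simp: has_weight_def cartan_def vec_eq_iff bracket_cartan_elt component_def)

text \<open>The sum runs over the set of weights, not over positions, so two positions sharing a
  weight are still counted once.\<close>

lemma sum_component_eq:
  fixes x :: "('r, 'n::finite) gl2n"
  shows "(\<Sum>\<alpha>\<in>range (\<lambda>(p, q). rt p q). component \<alpha> x) = x"
proof -
  have "rt p q \<in> range (\<lambda>(p, q). rt p q)" for p q :: "'n + 'n" by auto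
  then show ?thesis by (simp add: vec_eq_iff component_def sum.delta')
qed

lemma has_weight_mscale: "has_weight \<alpha> x \<Longrightarrow> has_weight \<alpha> (mscale smul c x)"
  by (simp add: has_weight_def lie_bracket_mscale_right vec_eq_iff mult.commute)

lemma has_weight_0: "has_weight \<alpha> 0"
  by (simp add: has_weight_def vec_eq_iff)

lemma has_weight_add: "has_weight \<alpha> x \<Longrightarrow> has_weight \<alpha> y \<Longrightarrow> has_weight \<alpha> (x + y)"
  by (simp add: has_weight_def lie_bracket_add_right vec_eq_iff scale_right_distrib)

lemma has_weight_diff: "has_weight \<alpha> x \<Longrightarrow> has_weight \<alpha> y \<Longrightarrow> has_weight \<alpha> (x - y)"
  by (simp add: has_weight_def lie_bracket_diff_right vec_eq_iff scale_right_diff_distrib)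

text \<open>Applied to the zero subspace, the following lemma shows that weight vectors of distinct
  weights are linearly independent.\<close>

lemma weight_vector_mem:
  fixes W :: "('r, 'n::finite) gl2n set"
  assumes W: "module.subspace (mscale smul) W"
    and stable: "\<And>h x. h \<in> cartan smul \<Longrightarrow> x \<in> W \<Longrightarrow> lie_bracket h x \<in> W"
    and "finite S" "\<alpha> \<notin> S"
    and "\<And>\<beta>. \<beta> \<in> S \<Longrightarrow> \<exists>h\<in>cartan smul. \<alpha> h \<noteq> \<beta> h"
    and "\<And>\<beta>. \<beta> \<in> insert \<alpha> S \<Longrightarrow> has_weight \<beta> (z \<beta>)"
    and "z \<alpha> + (\<Sum>\<beta>\<in>S. z \<beta>) \<in> W"
  shows "z \<alpha> \<in> W"
  using assms(3-)
proof (induction S arbitrary: z rule: finite_induct)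
  case empty
  then show ?case by simp
next
  case (insert \<beta> S)
  interpret M: vector_space "mscale smul :: 'k \<Rightarrow> ('r, 'n) gl2n \<Rightarrow> ('r, 'n) gl2n"
    by (rule vector_space_mscale)
  from insert.prems(2)[of \<beta>] obtain h where h: "h \<in> cartan smul" "\<alpha> h \<noteq> \<beta> h" by auto
  let ?x = "z \<alpha> + (\<Sum>\<gamma>\<in>insert \<beta> S. z \<gamma>)"
  let ?z = "\<lambda>\<gamma>. mscale smul (\<gamma> h - \<beta> h) (z \<gamma>)"
  have br: "lie_bracket h (z \<gamma>) = mscale smul (\<gamma> h) (z \<gamma>)" if "\<gamma> \<in> insert \<alpha> (insert \<beta> S)" for \<gamma>
    using insert.prems(3)[OF that] h by (simp add: has_weight_def)
  \<comment> \<open>Acting by \<open>h\<close> minus the scalar \<open>\<beta> h\<close> removes the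
    summand of weight \<open>\<beta>\<close> and rescales the others; the factor at
    \<open>\<alpha>\<close> is nonzero and can be divided out at the end.\<close>
  have "lie_bracket h ?x - mscale smul (\<beta> h) ?x = ?z \<alpha> + (\<Sum>\<gamma>\<in>insert \<beta> S. ?z \<gamma>)"
    using br by (simp add: lie_bracket_add_right lie_bracket_sum_right M.scale_right_distrib
        M.scale_sum_right M.scale_left_diff_distrib sum_subtractf algebra_simps)
  also have "\<dots> = ?z \<alpha> + (\<Sum>\<gamma>\<in>S. ?z \<gamma>)"
    using insert.hyps by simp
  finally have eq: "lie_bracket h ?x - mscale smul (\<beta> h) ?x = ?z \<alpha> + (\<Sum>\<gamma>\<in>S. ?z \<gamma>)" .
  have "lie_bracket h ?x - mscale smul (\<beta> h) ?x \<in> W"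
    using W stable[OF h(1) insert.prems(4)] M.subspace_scale[OF W insert.prems(4)]
    by (rule M.subspace_diff)
  then have "?z \<alpha> + (\<Sum>\<gamma>\<in>S. ?z \<gamma>) \<in> W" unfolding eq .
  then have "?z \<alpha> \<in> W"
    by (rule insert.IH[rotated -1]) (use insert.prems in \<open>auto intro: has_weight_mscale\<close>)
  from M.subspace_scale[OF W this, of "inverse (\<alpha> h - \<beta> h)"] h show ?case by simp
qed

text \<open>For weights of the form \<open>rt p q\<close>, distinctness as functions already gives a
  separating Cartan element, by \<open>rt_eq_on_cartan\<close>.\<close>

lemma weight_vector_mem':
  fixes W :: "('r, 'n::finite) gl2n set"
  assumes W: "module.subspace (mscale smul) W"
    and stable: "\<And>h x. h \<in> cartan smul \<Longrightarrow> x \<in> W \<Longrightarrow> lie_bracket h x \<in> W"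
    and S: "S \<subseteq> range (\<lambda>(p, q). rt p q)" and "\<alpha> \<in> S"
    and "\<And>\<beta>. \<beta> \<in> S \<Longrightarrow> has_weight \<beta> (z \<beta>)"
    and "(\<Sum>\<beta>\<in>S. z \<beta>) \<in> W"
  shows "z \<alpha> \<in> W"
proof (rule weight_vector_mem[OF W stable, where S = "S - {\<alpha>}"])
  have fin: "finite S" using S by (rule finite_subset) simp
  then show "finite (S - {\<alpha>})" by simp
  show "z \<alpha> + (\<Sum>\<beta>\<in>S - {\<alpha>}. z \<beta>) \<in> W"
    using assms(6) sum.remove[OF fin \<open>\<alpha> \<in> S\<close>, of z] by simp
  show "\<exists>h\<in>cartan smul. \<alpha> h \<noteq> \<beta> h" if mem: "\<beta> \<in> S - {\<alpha>}" for \<beta>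
  proof (rule ccontr)
    assume "\<not> (\<exists>h\<in>cartan smul. \<alpha> h \<noteq> \<beta> h)"
    moreover have "\<exists>p q. \<gamma> = rt p q" if "\<gamma> \<in> S" for \<gamma>
      using subsetD[OF S that] by auto
    then obtain p q r s where "\<alpha> = rt p q" "\<beta> = rt r s"
      using \<open>\<alpha> \<in> S\<close> mem by (metis DiffD1)
    ultimately have "\<alpha> = \<beta>" using rt_eq_on_cartan by metis
    with mem show False by simp
  qed
qed (use assms in auto)

text \<open>By \<open>rt_eq_iff\<close> the support consists of \<open>(p, q)\<close> and its
  partner. They coincide for \<open>q = opp p\<close>, where the entry must be counted once rather
  than twice.\<close>

lemma component_rt:
  assumes "skew x" "p \<noteq> q"
  shows "component (rt p q) x = (if q = opp p then e_mat p q (x $ p $ q)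
    else e_mat p q (x $ p $ q) - e_mat (opp q) (opp p) (smul (pos_sign p q) (bar (x $ p $ q))))"
proof -
  have opp: "opp q = p \<longleftrightarrow> q = opp p" "p = opp q \<longleftrightarrow> q = opp p" by (metis opp_opp)+
  have "x $ opp q $ opp p = - smul (pos_sign p q) (bar (x $ p $ q))"
    using assms(1) by (simp add: skew_def)
  then show ?thesis
    by (auto simp: vec_eq_iff component_def rt_eq_iff[OF assms(2)] opp)
qed

text \<open>For long roots \<open>G i i b\<close> has the entry b - \<rho> bar b. A skew matrix has
  an entry c there with c = -\<rho> bar c, so b = c/2 recovers it; the same holds for
  \<open>H\<close>.\<close>

lemma component_FGH:
  assumes "skew x"
  shows "i \<noteq> j \<Longrightarrow> component (rt (Inl i) (Inl j)) x = F i j (x $ Inl i $ Inl j)"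
    and "i \<noteq> j \<Longrightarrow> component (rt (Inl i) (Inr j)) x = G i j (x $ Inl i $ Inr j)"
    and "i \<noteq> j \<Longrightarrow> component (rt (Inr i) (Inl j)) x = H i j (x $ Inr i $ Inl j)"
    and "component (rt (Inl i) (Inr i)) x = G i i (smul (1/2) (x $ Inl i $ Inr i))"
    and "component (rt (Inr i) (Inl i)) x = H i i (smul (1/2) (x $ Inr i $ Inl i))"
proof -
  show "component (rt (Inl i) (Inl j)) x = F i j (x $ Inl i $ Inl j)"
    "component (rt (Inl i) (Inr j)) x = G i j (x $ Inl i $ Inr j)"
    "component (rt (Inr i) (Inl j)) x = H i j (x $ Inr i $ Inl j)" if "i \<noteq> j"
    using that by (simp_all add: component_rt[OF assms] f_mat_def G_eq H_eq pos_sign_def)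
  have sym: "- smul \<rho> (bar (x $ Inl i $ Inr i)) = x $ Inl i $ Inr i"
    "- smul \<rho> (bar (x $ Inr i $ Inl i)) = x $ Inr i $ Inl i"
    using assms[unfolded skew_def, rule_format, of "Inl i" "Inr i"]
      assms[unfolded skew_def, rule_format, of "Inr i" "Inl i"] by (simp_all add: pos_sign_def)
  have half: "smul (1/2) b - smul \<rho> (bar (smul (1/2) b)) = b" if "- smul \<rho> (bar b) = b" for b
  proof -
    have "smul \<rho> (bar (smul (1/2) b)) = smul (1/2) (smul \<rho> (bar b))" by (simp add: mult.commute)
    also have "smul \<rho> (bar b) = - b" using that by (metis minus_minus)
    finally show ?thesis by simp
  qed
  show "component (rt (Inl i) (Inr i)) x = G i i (smul (1/2) (x $ Inl i $ Inr i))"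
    using half[OF sym(1)] by (simp add: component_rt[OF assms] G_eq e_mat_diff[symmetric])
  show "component (rt (Inr i) (Inl i)) x = H i i (smul (1/2) (x $ Inr i $ Inl i))"
    using half[OF sym(2)] by (simp add: component_rt[OF assms] H_eq e_mat_diff[symmetric])
qed

lemma diagonal_FF:
  assumes "skew x" "\<And>p q. p \<noteq> q \<Longrightarrow> x $ p $ q = 0"
  shows "x = (\<Sum>i\<in>UNIV. F i i (x $ Inl i $ Inl i))"
proof -
  have "x $ p $ q = (\<Sum>i\<in>UNIV. F i i (x $ Inl i $ Inl i)) $ p $ q" for p q
  proof (cases p)
    case (Inl k)
    have "(\<Sum>i\<in>UNIV. F i i (x $ Inl i $ Inl i) $ p $ q) = (\<Sum>i\<in>UNIV. if i = k then x $ p $ q else 0)"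
      using assms(2)[of p q] by (intro sum.cong) (auto simp: Inl f_mat_def)
    then show ?thesis by simp
  next
    case (Inr k)
    have "x $ Inr k $ Inr k = - bar (x $ Inl k $ Inl k)"
      using assms(1)[unfolded skew_def, rule_format, of "Inl k" "Inl k"] by (simp add: pos_sign_def)
    then have "(\<Sum>i\<in>UNIV. F i i (x $ Inl i $ Inl i) $ p $ q) = (\<Sum>i\<in>UNIV. if i = k then x $ p $ q else 0)"
      using assms(2)[of p q] by (intro sum.cong) (auto simp: Inr f_mat_def)
    then show ?thesis by simp
  qed
  then show ?thesis unfolding vec_eq_iff by blast
qed

end

section \<open>Ideals\<close>

locale involutive_lie_ideal = split_involutive_algebra smul bar \<rho>
  for smul :: "'k::field_char_0 \<Rightarrow> 'r::ring_1 \<Rightarrow> 'r" and bar :: "'r \<Rightarrow> 'r" and \<rho> :: 'k +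
  fixes K :: "('r, 'n::{finite,linorder}) gl2n set"
  assumes card_ge_3: "CARD('n) \<ge> 3"
    and ideal: "lie_ideal smul (lie_g smul bar \<rho>) K"
begin

sublocale M: vector_space "mscale smul :: 'k \<Rightarrow> ('r, 'n) gl2n \<Rightarrow> ('r, 'n) gl2n"
  by (rule vector_space_mscale)

lemma subspace_K: "M.subspace K"
  and K_lie_g: "x \<in> K \<Longrightarrow> x \<in> lie_g smul bar \<rho>"
  and bracket_left_K: "y \<in> lie_g smul bar \<rho> \<Longrightarrow> x \<in> K \<Longrightarrow> lie_bracket y x \<in> K"
  using ideal by (auto simp: lie_ideal_def)

lemmas K_add = M.subspace_add[OF subspace_K] and K_diff = M.subspace_diff[OF subspace_K]
  and K_scale = M.subspace_scale[OF subspace_K] and K_sum = M.subspace_sum[OF subspace_K]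
  and K_neg = M.subspace_neg[OF subspace_K] and K_0 = M.subspace_0[OF subspace_K]

lemma bracket_right_K: "x \<in> K \<Longrightarrow> y \<in> lie_g smul bar \<rho> \<Longrightarrow> lie_bracket x y \<in> K"
  using K_neg bracket_left_K lie_bracket_swap[of x y] by metis

lemma K_neg_iff: "- x \<in> K \<longleftrightarrow> x \<in> K"
  using K_neg[of x] K_neg[of "- x"] by auto

lemma K_half: "x + x \<in> K \<Longrightarrow> x \<in> K"
  using K_scale[of "x + x" "1/2"] by simp

lemma add_closed_K: "add_closed K"
  by (simp add: add_closed_def K_0 K_add)

text \<open>This is how \<open>card_ge_3\<close> enters: a third index lets brackets avoid diagonal
  and long root terms.\<close>

lemma obtain_third:
  obtains k :: 'n where "k \<noteq> i" "k \<noteq> j"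
proof -
  have "card {i, j} \<le> 2" by (simp add: card_insert_if)
  then have "{i, j} \<noteq> UNIV" using card_ge_3 by auto
  then show thesis using that by auto
qed

section \<open>Off-diagonal positions and the common involutive ideal\<close>

lemma F_mult_right:
  assumes "F i j a \<in> K" "i \<noteq> j" "i \<noteq> k" "j \<noteq> k"
  shows "F i k (a * b) \<in> K"
  using bracket_right_K[OF assms(1) FGH_in_lie_g(1)[OF assms(4), of b]] assms
  by (simp add: bracket_FF)

lemma F_mult_left:
  assumes "F i j a \<in> K" "i \<noteq> j" "i \<noteq> k" "j \<noteq> k"
  shows "F k j (b * a) \<in> K"
  using bracket_left_K[OF FGH_in_lie_g(1)[OF assms(3)[symmetric], of b] assms(1)] assms
  by (simp add: bracket_FF)

text \<open>Row and column moves change one index at a time and must stay off the diagonal. If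
  \<open>k = j\<close>, changing the row directly would land on \<open>(j, j)\<close>, so the path
  passes through a third column \<open>m\<close>.\<close>

lemma F_move:
  assumes "F i j a \<in> K" "i \<noteq> j" "k \<noteq> l"
  shows "F k l a \<in> K"
proof -
  have row: "F i k a \<in> K" if "F i j a \<in> K" "i \<noteq> j" "i \<noteq> k" for i j k
    using F_mult_right[of i j a k 1] that by (cases "j = k") auto
  have col: "F k j a \<in> K" if "F i j a \<in> K" "i \<noteq> j" "j \<noteq> k" for i j k
    using F_mult_left[of i j a k 1] that by (cases "i = k") auto
  show ?thesis
  proof (cases "k = j")
    case True
    obtain m where "m \<noteq> i" "m \<noteq> j" using obtain_third .
    then show ?thesis using row[of i j m] col[of i m k] row[of k m l] assms True by simp
  next
    case False
    then show ?thesis using col[of i j k] row[of k j l] assms by simp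
  qed
qed

definition base_ideal :: "'r set" where
  "base_ideal = {a. \<exists>i j. i \<noteq> j \<and> F i j a \<in> K}"

lemma F_mem_iff: "i \<noteq> j \<Longrightarrow> F i j a \<in> K \<longleftrightarrow> a \<in> base_ideal"
  using F_move unfolding base_ideal_def by blast

lemma G_mem_iff:
  assumes "i \<noteq> j"
  shows "G i j a \<in> K \<longleftrightarrow> a \<in> base_ideal"
proof
  obtain k where k: "k \<noteq> i" "k \<noteq> j" using obtain_third .
  show "a \<in> base_ideal" if "G i j a \<in> K"
    using bracket_right_K[OF that FGH_in_lie_g(3)[of j k 1]] k assms
    by (simp add: bracket_GH F_mem_iff)
  assume "a \<in> base_ideal"
  then have "F i k a \<in> K" using k by (simp add: F_mem_iff)
  then show "G i j a \<in> K"
    using bracket_right_K[OF _ FGH_in_lie_g(2)[of k j 1]] k assms by (fastforce simp: bracket_FG)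
qed

lemma H_mem_base:
  assumes "i \<noteq> j" "H i j a \<in> K"
  shows "a \<in> base_ideal"
proof -
  obtain k where k: "k \<noteq> i" "k \<noteq> j" using obtain_third .
  show ?thesis
    using bracket_left_K[OF FGH_in_lie_g(2)[of k i 1] assms(2)] k assms(1)
    by (simp add: bracket_GH F_mem_iff)
qed

text \<open>Going from \<open>F\<close> to \<open>H\<close> conjugates the coefficient, whereas
  \<open>H_mem_base\<close> returns from \<open>H\<close> to \<open>F\<close> without conjugation.
  The round trip is what makes \<open>base_ideal\<close> closed under \<open>bar\<close>.\<close>

lemma H_mem_bar:
  assumes "i \<noteq> j" "a \<in> base_ideal"
  shows "H i j (bar a) \<in> K"
proof -
  obtain k where k: "k \<noteq> i" "k \<noteq> j" using obtain_third .
  then have "F k i a \<in> K" using assms by (simp add: F_mem_iff)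
  from bracket_right_K[OF this FGH_in_lie_g(3)[of k j 1]] have "- H i j (bar a) \<in> K"
    using k assms(1) by (simp add: bracket_FH)
  then show ?thesis using K_neg by fastforce
qed

lemma base_bar: "a \<in> base_ideal \<Longrightarrow> bar a \<in> base_ideal"
proof -
  obtain i j :: 'n where "i \<noteq> j" using obtain_third by metis
  then show "a \<in> base_ideal \<Longrightarrow> bar a \<in> base_ideal" using H_mem_base H_mem_bar by blast
qed

lemma H_mem_iff: "i \<noteq> j \<Longrightarrow> H i j a \<in> K \<longleftrightarrow> a \<in> base_ideal"
  using H_mem_base H_mem_bar[of i j "bar a"] base_bar by auto

lemma involutive_base_ideal: "involutive_ideal smul bar base_ideal"
proof -
  obtain i j :: 'n where ij: "i \<noteq> j" using obtain_third by metis
  obtain k where k: "k \<noteq> i" "k \<noteq> j" using obtain_third .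
  have "subspace base_ideal"
    using F_mem_iff[OF ij] by (simp add: subspace_def FGH_add FGH_smul K_add K_scale K_0 flip: F_mem_iff[OF ij])
  moreover have "a * b \<in> base_ideal" if "a \<in> base_ideal" for a b
    using F_mult_right[of i j a k b] that ij k by (simp add: F_mem_iff)
  moreover have "b * a \<in> base_ideal" if "a \<in> base_ideal" for a b
    using F_mult_left[of i j a k b] that ij k by (simp add: F_mem_iff)
  ultimately show ?thesis by (simp add: involutive_ideal_def base_bar)
qed

lemma subspace_base: "subspace base_ideal"
  and base_mult: "a \<in> base_ideal \<Longrightarrow> a * b \<in> base_ideal" "a \<in> base_ideal \<Longrightarrow> b * a \<in> base_ideal"
  using involutive_base_ideal by (auto simp: involutive_ideal_def)

lemmas base_add = subspace_add[OF subspace_base]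
  and base_scale = subspace_scale[OF subspace_base] and base_sum = subspace_sum[OF subspace_base]
  and base_0 = subspace_0[OF subspace_base] and base_neg = subspace_neg[OF subspace_base]

section \<open>Diagonal entries\<close>

lemma FF_diff_mem:
  assumes "a \<in> base_ideal"
  shows "F i i a - F j j a \<in> K"
proof (cases "i = j")
  case False
  then have "F i j a \<in> K" using assms by (simp add: F_mem_iff)
  from bracket_right_K[OF this FGH_in_lie_g(1)[of j i 1]] False show ?thesis
    by (simp add: bracket_FF)
qed (simp add: K_0)

lemma FF_diff_mem_iff:
  assumes "i \<noteq> j"
  shows "F i i a - F j j a \<in> K \<longleftrightarrow> a \<in> base_ideal"
proof
  \<comment> \<open>With \<open>k\<close> different from \<open>j\<close>, the bracket with
    \<open>F i k 1\<close> annihilates the \<open>j\<close> term and leaves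
    \<open>F i k a\<close>.\<close>
  obtain k where k: "k \<noteq> i" "k \<noteq> j" using obtain_third .
  assume "F i i a - F j j a \<in> K"
  from bracket_right_K[OF this FGH_in_lie_g(1)[of i k 1]] k assms show "a \<in> base_ideal"
    by (simp add: lie_bracket_diff_left bracket_FF F_mem_iff)
qed (rule FF_diff_mem)

lemma FF_mem_base:
  assumes "F i i a \<in> K"
  shows "a \<in> base_ideal"
proof -
  obtain k where k: "k \<noteq> i" using obtain_third by metis
  from bracket_right_K[OF assms FGH_in_lie_g(1)[of i k 1]] k show ?thesis
    by (simp add: bracket_FF F_mem_iff)
qed

lemma FF_move: "F i i a \<in> K \<Longrightarrow> F j j a \<in> K"
  using K_add[OF FF_diff_mem[OF FF_mem_base, of i a j i], of "F i i a"] by simp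

text \<open>This bound comes from the trace condition on all of \<open>lie_g\<close>: the trace of
  \<open>F i i a\<close> is \<open>a - bar a\<close>.\<close>

lemma FF_mem_sym:
  assumes "F i i a \<in> K"
  shows "a \<in> bar_eigenspace smul bar 1 + comm_span smul UNIV UNIV"
  using lie_g_subset(2)[OF K_lie_g[OF assms]] by (simp add: mem_sym_plus_comm_iff trace_FF)

text \<open>For commutators, \<open>bracket_FF\<close> gives
  \<open>F i i (a * b) - F j j (b * a)\<close>, and a known difference moves the second term to
  \<open>i\<close>. For symmetric \<open>a\<close>, \<open>bracket_GH\<close> gives the sum of the
  entries at \<open>i\<close> and \<open>j\<close>; adding their difference leaves twice the entry
  at \<open>i\<close>.\<close>

lemma FF_mem:
  assumes "a \<in> (base_ideal \<inter> bar_eigenspace smul bar 1) + comm_span smul base_ideal UNIV"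
  shows "F i i a \<in> K"
proof -
  obtain j where j: "j \<noteq> i" using obtain_third by metis
  have comm: "F i i (a * b - b * a) \<in> K" if "a \<in> base_ideal" for a b
  proof -
    have "F i j a \<in> K" using j that by (simp add: F_mem_iff)
    from bracket_right_K[OF this FGH_in_lie_g(1)[of j i b]] j
    have "F i i (a * b) - F j j (b * a) \<in> K" by (simp add: bracket_FF)
    from K_diff[OF this FF_diff_mem[of "b * a" i j]] that show ?thesis
      by (simp add: base_mult FGH_diff)
  qed
  have "subspace {a. F i i a \<in> K}"
    by (simp add: subspace_def K_0 FGH_add FGH_smul K_add K_scale)
  then have "comm_span smul base_ideal UNIV \<subseteq> {a. F i i a \<in> K}"
    unfolding comm_span_def by (intro span_minimal) (auto intro: comm)
  moreover have "F i i a \<in> K" if "a \<in> base_ideal" "bar a = a" for a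
  proof -
    have "G i j a \<in> K" using j that by (simp add: G_mem_iff)
    from bracket_right_K[OF this FGH_in_lie_g(3)[of j i 1]] j that
    have "F i i a + F j j a \<in> K" by (simp add: bracket_GH)
    from K_add[OF this FF_diff_mem[OF that(1), of i j]] have "F i i a + F i i a \<in> K"
      by (simp add: algebra_simps)
    then show ?thesis by (rule K_half)
  qed
  ultimately show ?thesis
    using assms by (auto simp: set_plus_def bar_eigenspace_def FGH_add intro!: K_add)
qed

section \<open>Long roots\<close>

lemma GG_HH_bar:
  "G i i (bar a) = mscale smul (- \<rho>) (G i i a)" "H i i (bar a) = mscale smul (- \<rho>) (H i i a)"
  using G_swap[where i = i and j = i and a = "bar a"] H_swap[where i = i and j = i and a = "bar a"]
  by simp_all

lemma GG_mem:
  assumes "a \<in> base_ideal"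
  shows "G i i a \<in> K"
proof -
  obtain j where j: "j \<noteq> i" using obtain_third by metis
  then have "F i j a \<in> K" using assms by (simp add: F_mem_iff)
  from bracket_right_K[OF this FGH_in_lie_g(2)[of j i 1]] j show ?thesis
    by (simp add: bracket_FG)
qed

lemma HH_mem:
  assumes "a \<in> base_ideal"
  shows "H i i a \<in> K"
proof -
  obtain j where j: "j \<noteq> i" using obtain_third by metis
  then have "F j i a \<in> K" using assms by (simp add: F_mem_iff)
  from bracket_right_K[OF this FGH_in_lie_g(3)[of i j 1]] j show ?thesis
    by (simp add: bracket_FH K_neg_iff)
qed

text \<open>The bracket with \<open>F j i 1\<close> moves the coefficient to short root positions.
  Its two terms lie at mirror places, and \<open>G_swap\<close> merges them into one coefficient,
  which no longer sees the R_\<rho> part of \<open>a\<close>.\<close>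

lemma GG_mem_base:
  assumes "G i i a \<in> K"
  shows "a - smul \<rho> (bar a) \<in> base_ideal"
proof -
  obtain j where j: "j \<noteq> i" using obtain_third by metis
  from bracket_left_K[OF FGH_in_lie_g(1)[of j i 1] assms] j
  have "G j i a + G i j a \<in> K" by (simp add: bracket_FG)
  moreover have "G i j a = - G j i (smul \<rho> (bar a))"
    by (subst G_swap) (simp add: FGH_smul)
  ultimately have "G j i (a - smul \<rho> (bar a)) \<in> K" by (simp add: FGH_diff)
  then show ?thesis using j by (simp add: G_mem_iff)
qed

lemma HH_mem_base:
  assumes "H i i a \<in> K"
  shows "a - smul \<rho> (bar a) \<in> base_ideal"
proof -
  obtain j where j: "j \<noteq> i" using obtain_third by metis
  from K_neg[OF bracket_left_K[OF FGH_in_lie_g(1)[of i j 1] assms]] j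
  have "H j i a + H i j a \<in> K" by (simp add: bracket_FH add.commute)
  moreover have "H i j a = - H j i (smul \<rho> (bar a))"
    by (subst H_swap) (simp add: FGH_smul)
  ultimately have "H j i (a - smul \<rho> (bar a)) \<in> K" by (simp add: FGH_diff)
  then show ?thesis using j by (simp add: H_mem_iff)
qed

lemma eigenspace_decomposition:
  assumes "a - smul \<rho> (bar a) \<in> base_ideal"
  shows "a \<in> (base_ideal \<inter> bar_eigenspace smul bar (- \<rho>)) + bar_eigenspace smul bar \<rho>"
proof -
  have half: "smul (1/2) u \<in> bar_eigenspace smul bar c" if "bar u = smul c u" for u c
    unfolding bar_eigenspace_def mem_Collect_eq bar_smul that by (rule scale_left_commute)
  have "a = smul (1/2) (a - smul \<rho> (bar a)) + smul (1/2) (a + smul \<rho> (bar a))"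
    by (simp add: scale_right_distrib scale_right_diff_distrib)
  moreover have "smul (1/2) (a - smul \<rho> (bar a)) \<in> bar_eigenspace smul bar (- \<rho>)"
    by (rule half) (simp add: scale_right_diff_distrib)
  moreover have "smul (1/2) (a + smul \<rho> (bar a)) \<in> bar_eigenspace smul bar \<rho>"
    by (rule half) (simp add: scale_right_distrib)
  moreover have "smul (1/2) (a - smul \<rho> (bar a)) \<in> base_ideal"
    using base_scale[OF assms] .
  ultimately show ?thesis by (metis IntI set_plus_intro)
qed

lemma eigenspaces_disjoint:
  "(base_ideal \<inter> bar_eigenspace smul bar (- \<rho>)) \<inter> bar_eigenspace smul bar \<rho> = {0}"
proof -
  have "a = 0" if "bar a = - smul \<rho> a" "bar a = smul \<rho> a" for a
  proof -
    have "smul \<rho> a + smul \<rho> a = 0" using that by (metis add.right_inverse)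
    then have "smul \<rho> (smul \<rho> a) = 0" using double_eq_0 by (metis scale_zero_right)
    then show ?thesis by simp
  qed
  then show ?thesis by (auto simp: bar_eigenspace_def base_0)
qed

text \<open>The maps \<open>G i i\<close> and \<open>H i i\<close> factor through the projection
  onto R_{-\<rho>}. So \<open>a\<close> may lie outside \<open>base_ideal\<close> while its
  projection lies inside and has the same image.\<close>

lemma GG_HH_skew_part:
  fixes i :: 'n
  shows "G i i (smul (1/2) (a - smul \<rho> (bar a))) = G i i a"
  "H i i (smul (1/2) (a - smul \<rho> (bar a))) = H i i a"
  by (simp_all add: FGH_smul FGH_diff GG_HH_bar)

lemma GG_image: "G i i ` {a. G i i a \<in> K} = G i i ` base_ideal"
proof
  show "G i i ` {a. G i i a \<in> K} \<subseteq> G i i ` base_ideal"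
    using GG_mem_base base_scale by (auto simp: image_iff) (metis GG_HH_skew_part(1))
qed (auto simp: GG_mem)

lemma HH_image: "H i i ` {a. H i i a \<in> K} = H i i ` base_ideal"
proof
  show "H i i ` {a. H i i a \<in> K} \<subseteq> H i i ` base_ideal"
    using HH_mem_base base_scale by (auto simp: image_iff) (metis GG_HH_skew_part(2))
qed (auto simp: HH_mem)

section \<open>Stability under the Cartan subalgebra and weight components\<close>

lemma cartan_subset_lie_g: "h \<in> cartan smul \<Longrightarrow> h \<in> (lie_g smul bar \<rho> :: ('r, 'n) gl2n set)"
proof -
  let ?g = "lie_g smul bar \<rho> :: ('r, 'n) gl2n set"
  have sub: "M.subspace ?g" and br: "\<And>x y. x \<in> ?g \<Longrightarrow> y \<in> ?g \<Longrightarrow> lie_bracket x y \<in> ?g"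
    using lie_subalgebra_lie_g by (auto simp: lie_subalgebra_def)
  have F1: "F i i 1 \<in> ?g" for i
  proof -
    obtain j where j: "j \<noteq> i" using obtain_third by metis
    \<comment> \<open>The first bracket is the difference and the second the sum of the diagonal
      elements at \<open>i\<close> and \<open>j\<close>, so twice \<open>F i i 1\<close>
      remains.\<close>
    have "lie_bracket (F i j 1) (F j i 1) + lie_bracket (G i j 1) (H j i 1) \<in> ?g"
      using j by (intro M.subspace_add[OF sub] br FGH_in_lie_g) auto
    then have "F i i 1 + F i i 1 \<in> ?g" using j by (simp add: bracket_FF bracket_GH)
    from M.subspace_scale[OF sub this, of "1/2"] show ?thesis by simp
  qed
  assume "h \<in> cartan smul"
  then obtain a where "h = (\<Sum>i\<in>UNIV. mscale smul (a i) (F i i 1))"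
    by (auto simp: cartan_def cartan_elt_def f_mat_def)
  then show "h \<in> ?g" using F1 by (auto intro!: M.subspace_sum[OF sub] M.subspace_scale[OF sub])
qed

lemma component_mem:
  assumes "x \<in> K"
  shows "component (rt p q) x \<in> K"
proof (rule weight_vector_mem'[OF subspace_K, where S = "range (\<lambda>(p, q). rt p q)"])
  show "(\<Sum>\<beta>\<in>range (\<lambda>(p, q). rt p q). component \<beta> x) \<in> K"
    using assms by (simp only: sum_component_eq)
qed (auto simp: has_weight_component bracket_left_K cartan_subset_lie_g)

lemma skew_K: "x \<in> K \<Longrightarrow> skew x"
  using K_lie_g lie_g_subset(1) by blast

text \<open>The average serves two purposes: the deviations \<open>a i - c\<close> sum to 0, so they
  fit into \<open>f_diff\<close>, and \<open>c\<close> inherits the trace condition, which controls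
  only the sum of the \<open>a i\<close>.\<close>

lemma diagonal_mem_K:
  assumes z: "(\<Sum>i\<in>UNIV. F i i (a i)) \<in> K"
  defines "c \<equiv> smul (1 / of_nat CARD('n)) (\<Sum>i\<in>UNIV. a i)"
  shows "c \<in> (bar_eigenspace smul bar 1 + comm_span smul UNIV UNIV) \<inter> comm_hat base_ideal
      \<inter> plus_hat bar base_ideal"
    and "a i - c \<in> base_ideal"
    and "(\<Sum>i\<in>UNIV. F i i (a i)) = (\<Sum>i\<in>UNIV. F i i c) +
      (\<Sum>i\<in>UNIV - {fst_idx}. F i i (a i - c) - F fst_idx fst_idx (a i - c))"
proof -
  let ?z = "\<Sum>i\<in>UNIV. F i i (a i)"
  let ?n = "of_nat CARD('n) :: 'k"
  have n: "?n \<noteq> 0" by simp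
  have const: "(\<Sum>j\<in>(UNIV :: 'n set). b) = smul ?n b" for b
    by (rule sum_constant_scale)
  have nc: "smul ?n c = (\<Sum>i\<in>UNIV. a i)" by (simp add: c_def)
  have comm: "a i * b - b * a j \<in> base_ideal" if "i \<noteq> j" for i j b
  proof -
    have "lie_bracket ?z (F i j b) = F i j (a i * b - b * a j)"
      by (simp add: lie_bracket_sum_left bracket_FF sum_subtractf FGH_diff)
    then show ?thesis
      using bracket_right_K[OF z FGH_in_lie_g(1)[OF that, of b]] that by (simp add: F_mem_iff)
  qed
  have plus: "a i + bar (a j) \<in> base_ideal" if "i \<noteq> j" for i j
  proof -
    have "lie_bracket ?z (G i j 1) = G i j (a i + bar (a j))"
      by (simp add: lie_bracket_sum_left bracket_FG sum.distrib FGH_add)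
    then show ?thesis
      using bracket_right_K[OF z FGH_in_lie_g(2)[of i j 1]] that by (simp add: G_mem_iff)
  qed
  have diff: "a i - a j \<in> base_ideal" for i j
    using comm[of i j 1] by (cases "i = j") (simp_all add: base_0)
  show ac: "a i - c \<in> base_ideal" for i
  proof -
    \<comment> \<open>The n-fold deviation is a sum of pairwise differences, each already in the
      ideal; characteristic 0 allows division by n.\<close>
    have "smul ?n (a i - c) = (\<Sum>j\<in>UNIV. a i - a j)"
      by (simp add: scale_right_diff_distrib nc sum_subtractf const del: sum_constant)
    then have "smul ?n (a i - c) \<in> base_ideal" by (simp add: base_sum diff)
    from base_scale[OF this, of "1 / ?n"] show ?thesis by simp
  qed
  then have ca: "c - a i \<in> base_ideal" for i
    using base_neg by fastforce
  obtain i j :: 'n where ij: "i \<noteq> j" using obtain_third by metis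
  \<comment> \<open>The relation known for \<open>a i\<close> and \<open>a j\<close> is transferred
    to \<open>c\<close> at the cost of deviations lying in the two-sided ideal.\<close>
  have "c * r - r * c = (c - a i) * r + (a i * r - r * a j) + r * (a j - c)" for r
    by (simp add: algebra_simps)
  then have "c \<in> comm_hat base_ideal"
    using comm[OF ij] ca ac by (simp add: comm_hat_def base_add base_mult)
  moreover have "c + bar c = (c - a i) + (a i + bar (a j)) + bar (c - a j)"
    by (simp add: algebra_simps)
  then have "c \<in> plus_hat bar base_ideal"
    using plus[OF ij] ca by (simp only: plus_hat_def mem_Collect_eq base_add base_bar)
  moreover have "c \<in> bar_eigenspace smul bar 1 + comm_span smul UNIV UNIV"
  proof -
    have "(\<Sum>i\<in>UNIV. a i - bar (a i)) = (\<Sum>i\<in>UNIV. \<Sum>p\<in>UNIV. F i i (a i) $ p $ p)"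
      by (simp add: trace_FF)
    also have "\<dots> = (\<Sum>p\<in>UNIV. ?z $ p $ p)"
      unfolding sum_component by (rule sum.swap)
    finally have "(\<Sum>i\<in>UNIV. a i) - bar (\<Sum>i\<in>UNIV. a i) \<in> comm_span smul UNIV UNIV"
      using lie_g_subset(2)[OF K_lie_g[OF z]] by (simp add: sum_subtractf bar_sum)
    from subspace_scale[OF subspace_comm_span this, of "1 / ?n"] show ?thesis
      by (simp add: mem_sym_plus_comm_iff c_def scale_right_diff_distrib)
  qed
  ultimately show "c \<in> (bar_eigenspace smul bar 1 + comm_span smul UNIV UNIV) \<inter> comm_hat base_ideal
      \<inter> plus_hat bar base_ideal" by simp
  \<comment> \<open>Because the deviations cancel, subtracting all of them at \<open>fst_idx\<close>
    changes nothing, and the term for \<open>fst_idx\<close> itself vanishes.\<close>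
  have "(\<Sum>i\<in>UNIV. a i - c) = 0"
    by (simp add: sum_subtractf const nc del: sum_constant)
  then have "(\<Sum>i\<in>UNIV. F fst_idx fst_idx (a i - c)) = (0 :: ('r, 'n) gl2n)"
    by (simp flip: F_sum)
  then have "(\<Sum>i\<in>UNIV. F i i (a i - c)) = (\<Sum>i\<in>UNIV. F i i (a i - c) - F fst_idx fst_idx (a i - c))"
    by (simp add: sum_subtractf)
  also have "\<dots> = (\<Sum>i\<in>UNIV - {fst_idx}. F i i (a i - c) - F fst_idx fst_idx (a i - c))"
    by (subst sum.remove[of _ fst_idx]) simp_all
  finally have eq: "(\<Sum>i\<in>UNIV. F i i (a i - c)) =
      (\<Sum>i\<in>UNIV - {fst_idx}. F i i (a i - c) - F fst_idx fst_idx (a i - c))" .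
  have "?z = (\<Sum>i\<in>UNIV. F i i c) + (\<Sum>i\<in>UNIV. F i i (a i - c))"
    by (simp add: FGH_diff sum_subtractf)
  then show "?z = (\<Sum>i\<in>UNIV. F i i c) +
      (\<Sum>i\<in>UNIV - {fst_idx}. F i i (a i - c) - F fst_idx fst_idx (a i - c))"
    unfolding eq .
qed

section \<open>The zero weight space\<close>

lemma diagonal_weight_iff:
  fixes x :: "('r, 'n) gl2n"
  shows "has_weight (\<lambda>h. 0) x \<longleftrightarrow> (\<forall>p q. p \<noteq> q \<longrightarrow> x $ p $ q = 0)"
proof
  assume x: "has_weight (\<lambda>h. 0) x"
  show "\<forall>p q. p \<noteq> q \<longrightarrow> x $ p $ q = 0"
  proof (intro allI impI)
    fix p q :: "'n + 'n"
    assume "p \<noteq> q"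
    then obtain a where a: "wt a p \<noteq> wt a q" using wt_eqD by blast
    have "lie_bracket (cartan_elt smul a) x = mscale smul 0 x"
      using x by (auto simp: has_weight_def cartan_def)
    then have "lie_bracket (cartan_elt smul a) x $ p $ q = 0" by simp
    then show "x $ p $ q = 0" using a by (simp add: bracket_cartan_elt)
  qed
next
  assume "\<forall>p q. p \<noteq> q \<longrightarrow> x $ p $ q = 0"
  then have "smul (wt a p - wt a q) (x $ p $ q) = 0" for a p q by (cases "p = q") auto
  then show "has_weight (\<lambda>h. 0) x"
    by (auto simp: has_weight_def cartan_def vec_eq_iff bracket_cartan_elt)
qed

lemma zero_weight_space:
  "f_scalar bar (bar_eigenspace smul bar 1 + comm_span smul UNIV UNIV) \<inter> K + f_diff bar UNIV \<inter> K =
    {x \<in> K. has_weight (\<lambda>h. 0) x}" (is "?A + ?B = ?Z")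
proof
  have Z: "add_closed ?Z"
    by (auto simp: add_closed_def K_0 K_add has_weight_0 has_weight_add)
  have D: "add_closed {x :: ('r, 'n) gl2n. has_weight (\<lambda>h. 0) x}"
    by (auto simp: add_closed_def has_weight_0 has_weight_add)
  have F: "has_weight (\<lambda>h. 0) (F i i a :: ('r, 'n) gl2n)" for i a
    by (auto simp: diagonal_weight_iff f_mat_def)
  have "?A \<subseteq> ?Z"
    using F by (auto simp: f_scalar_def intro!: add_closed_sum_mem[OF D, simplified])
  moreover have "f_diff bar UNIV \<subseteq> {x :: ('r, 'n) gl2n. has_weight (\<lambda>h. 0) x}"
    unfolding f_diff_def by (intro set_sum_subset D) (auto intro: has_weight_diff F)
  then have "?B \<subseteq> ?Z" by auto
  ultimately show "?A + ?B \<subseteq> ?Z" by (rule set_plus_subset[OF Z])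
  show "?Z \<subseteq> ?A + ?B"
  proof
    fix x assume "x \<in> ?Z"
    then have xK: "x \<in> K" and x0: "has_weight (\<lambda>h. 0) x" by auto
    define a where "a i = x $ Inl i $ Inl i" for i
    have x: "x = (\<Sum>i\<in>UNIV. F i i (a i))"
      unfolding a_def using diagonal_FF[OF skew_K[OF xK]] x0 by (simp add: diagonal_weight_iff)
    define c where "c = smul (1 / of_nat CARD('n)) (\<Sum>i\<in>UNIV. a i)"
    note d = diagonal_mem_K[of a, folded c_def, folded x, OF xK]
    let ?y = "\<Sum>i\<in>UNIV - {fst_idx}. F i i (a i - c) - F fst_idx fst_idx (a i - c)"
    let ?s = "\<Sum>i\<in>UNIV. F i i c"
    \<comment> \<open>Each part has to lie in \<open>K\<close> separately: \<open>?y\<close> does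
      since its coefficients are in \<open>base_ideal\<close>, and then \<open>?s\<close> does by
      subtraction.\<close>
    have y: "?y \<in> K" using d(2) by (intro K_sum FF_diff_mem)
    have "?s = x - ?y" using d(3) by simp
    then have "?s \<in> K" using K_diff[OF xK y] by simp
    moreover have "?s \<in> f_scalar bar (bar_eigenspace smul bar 1 + comm_span smul UNIV UNIV)"
      using d(1) by (auto simp: f_scalar_def)
    moreover have "?y \<in> f_diff bar UNIV"
      unfolding f_diff_def by (intro sum_mem_set_sum) auto
    ultimately have "?s + ?y \<in> ?A + ?B" using y by (intro set_plus_intro IntI)
    then show "x \<in> ?A + ?B" using d(3) by simp
  qed
qed

text \<open>The trace of the upper left block separates the two spaces: it vanishes on
  \<open>f_diff\<close> and is n times the coefficient on scalars.\<close>

lemma scalar_diff_disjoint: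
  "f_scalar bar S \<inter> f_diff bar UNIV \<subseteq> {0 :: ('r, 'n) gl2n}"
proof
  fix x :: "('r, 'n) gl2n"
  assume x: "x \<in> f_scalar bar S \<inter> f_diff bar UNIV"
  then obtain c where c: "x = (\<Sum>i\<in>UNIV. F i i c)" by (auto simp: f_scalar_def)
  let ?t = "\<lambda>x :: ('r, 'n) gl2n. \<Sum>i\<in>UNIV. x $ Inl i $ Inl i"
  have tF: "?t (F i i a) = a" for i a
  proof -
    have "?t (F i i a) = (\<Sum>k\<in>UNIV. if k = i then a else 0)"
      by (rule sum.cong) (auto simp: f_mat_def)
    then show ?thesis by simp
  qed
  have "f_diff bar UNIV \<subseteq> {x. ?t x = 0}"
    unfolding f_diff_def using tF
    by (intro set_sum_subset) (auto simp: add_closed_def sum.distrib sum_subtractf)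
  then have "?t x = 0" using x by auto
  moreover have "?t x = (\<Sum>i\<in>(UNIV :: 'n set). ?t (F i i c))"
    unfolding c sum_component by (rule sum.swap)
  ultimately have "smul (of_nat CARD('n)) c = 0"
    by (simp only: tF sum_constant_scale)
  then have "c = 0" by simp
  then show "x \<in> {0}" using c by simp
qed

lemma root_decomposition:
  "internal_direct_sum (mscale smul) (insert None (Some ` roots_C smul))
    (\<lambda>t. case t of
        None \<Rightarrow> f_scalar bar (bar_eigenspace smul bar 1 + comm_span smul UNIV UNIV) \<inter> K
          + f_diff bar UNIV \<inter> K
      | Some \<alpha> \<Rightarrow> root_space smul bar \<rho> \<alpha> \<inter> K) K"
proof -
  \<comment> \<open>\<open>\<phi>\<close> reads the index \<open>None\<close> as weight 0, so that
    every summand becomes a weight space of \<open>K\<close> and the weight lemmas apply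
    uniformly.\<close>
  define \<phi> :: "(('r, 'n) gl2n \<Rightarrow> 'k) option \<Rightarrow> ('r, 'n) gl2n \<Rightarrow> 'k"
    where "\<phi> t = (case t of None \<Rightarrow> \<lambda>h. 0 | Some \<alpha> \<Rightarrow> \<alpha>)" for t
  let ?I = "insert None (Some ` roots_C smul) :: (('r, 'n) gl2n \<Rightarrow> 'k) option set"
  let ?R = "range (\<lambda>(p, q). rt p q) :: (('r, 'n) gl2n \<Rightarrow> 'k) set"
  let ?W = "\<lambda>t. {x \<in> K. has_weight (\<phi> t) x}"
  have W: "(\<lambda>t. case t of
        None \<Rightarrow> f_scalar bar (bar_eigenspace smul bar 1 + comm_span smul UNIV UNIV) \<inter> K
          + f_diff bar UNIV \<inter> K
      | Some \<alpha> \<Rightarrow> root_space smul bar \<rho> \<alpha> \<inter> K) = ?W"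
    by (auto simp: fun_eq_iff zero_weight_space root_space_def has_weight_def \<phi>_def K_lie_g
        split: option.splits)
  have roots: "insert (\<lambda>h. 0) (roots_C smul) = ?R"
  proof -
    note zero_in_range_rt
    moreover have "roots_C smul \<subseteq> ?R" unfolding roots_C_eq by auto
    moreover have "\<alpha> \<in> insert (\<lambda>h. 0) (roots_C smul)" if "\<alpha> \<in> ?R" for \<alpha>
      using that unfolding roots_C_eq by (auto simp: rt_eq_0_iff)
    ultimately show ?thesis by blast
  qed
  have no0: "(\<lambda>h. 0) \<notin> (roots_C smul :: (('r, 'n) gl2n \<Rightarrow> 'k) set)"
  proof
    assume "(\<lambda>h. 0) \<in> (roots_C smul :: (('r, 'n) gl2n \<Rightarrow> 'k) set)"
    then obtain p q where "(rt p q :: ('r, 'n) gl2n \<Rightarrow> 'k) = (\<lambda>h. 0)" "p \<noteq> q"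
      unfolding roots_C_eq mem_Collect_eq by metis
    then show False by (simp add: rt_eq_0_iff)
  qed
  have \<phi>: "bij_betw \<phi> ?I ?R"
  proof (rule bij_betw_imageI)
    show "inj_on \<phi> ?I" using no0 by (auto simp: inj_on_def \<phi>_def)
    show "\<phi> ` ?I = ?R" unfolding roots[symmetric] by (auto simp: \<phi>_def image_image)
  qed
  have fin: "finite ?I" using bij_betw_finite[OF \<phi>] by simp
  have "bij_betw (\<lambda>w. \<Sum>t\<in>?I. w t) (Pi\<^sub>E ?I ?W) K"
  proof (rule bij_betw_imageI)
    show "inj_on (\<lambda>w. \<Sum>t\<in>?I. w t) (Pi\<^sub>E ?I ?W)"
    proof (rule inj_onI)
      fix v w assume v: "v \<in> Pi\<^sub>E ?I ?W" and w: "w \<in> Pi\<^sub>E ?I ?W"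
        and eq: "(\<Sum>t\<in>?I. v t) = (\<Sum>t\<in>?I. w t)"
      define \<psi> where "\<psi> = inv_into ?I \<phi>"
      have \<psi>: "\<psi> (\<phi> t) = t" if "t \<in> ?I" for t
        unfolding \<psi>_def using \<phi> that by (simp add: bij_betw_inv_into_left)
      \<comment> \<open>Two families with equal sums give weight vectors adding up to 0; their
        independence forces every difference to vanish.\<close>
      define z where "z \<beta> = v (\<psi> \<beta>) - w (\<psi> \<beta>)" for \<beta>
      have "(\<Sum>\<beta>\<in>?R. z \<beta>) = (\<Sum>t\<in>?I. z (\<phi> t))"
        by (rule sum.reindex_bij_betw[OF \<phi>, symmetric])
      also have "\<dots> = (\<Sum>t\<in>?I. v t - w t)"
        by (rule sum.cong) (simp_all only: z_def \<psi>)
      also have "\<dots> = 0" using eq by (simp only: sum_subtractf) simp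
      finally have sum0: "(\<Sum>\<beta>\<in>?R. z \<beta>) \<in> {0}" by simp
      have wts: "has_weight \<beta> (z \<beta>)" if "\<beta> \<in> ?R" for \<beta>
      proof -
        have "\<beta> \<in> \<phi> ` ?I" using that bij_betw_imp_surj_on[OF \<phi>] by simp
        then obtain t where t: "t \<in> ?I" "\<beta> = \<phi> t" by blast
        have "has_weight \<beta> (v t)" "has_weight \<beta> (w t)"
          using PiE_mem[OF v t(1)] PiE_mem[OF w t(1)] t(2) by auto
        then show ?thesis using t \<psi>[OF t(1)] by (simp add: z_def has_weight_diff)
      qed
      show "v = w"
      proof (rule PiE_ext[OF v w])
        fix t assume t: "t \<in> ?I"
        have "z (\<phi> t) \<in> {0}"
          using sum0
          by (rule weight_vector_mem'[OF M.subspace_single_0 _ subset_refl bij_betw_apply[OF \<phi> t] wts, rotated 2])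
            simp_all
        then show "v t = w t" using \<psi>[OF t] by (simp add: z_def)
      qed
    qed
    show "(\<lambda>w. \<Sum>t\<in>?I. w t) ` Pi\<^sub>E ?I ?W = K"
    proof
      show "(\<lambda>w. \<Sum>t\<in>?I. w t) ` Pi\<^sub>E ?I ?W \<subseteq> K"
        by (intro image_subsetI K_sum) (blast dest: PiE_mem)
      show "K \<subseteq> (\<lambda>w. \<Sum>t\<in>?I. w t) ` Pi\<^sub>E ?I ?W"
      proof
        fix x assume x: "x \<in> K"
        let ?w = "restrict (\<lambda>t. component (\<phi> t) x) ?I"
        have "component \<alpha> x \<in> K" if "\<alpha> \<in> ?R" for \<alpha>
          using that component_mem[OF x] by auto
        then have wPi: "?w \<in> Pi\<^sub>E ?I ?W"
          using bij_betw_apply[OF \<phi>] has_weight_component by (intro PiE_I) auto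
        have "(\<Sum>t\<in>?I. ?w t) = (\<Sum>t\<in>?I. component (\<phi> t) x)"
          by (rule sum.cong) simp_all
        then have "(\<Sum>t\<in>?I. ?w t) = x"
          using sum.reindex_bij_betw[OF \<phi>, of "\<lambda>\<alpha>. component \<alpha> x"]
          by (simp only: sum_component_eq)
        then show "x \<in> (\<lambda>w. \<Sum>t\<in>?I. w t) ` Pi\<^sub>E ?I ?W"
          by (rule image_eqI[OF sym wPi])
      qed
    qed
  qed
  moreover have "M.subspace (?W t)" for t
    by (simp add: M.subspace_def K_0 K_add K_scale has_weight_0 has_weight_add has_weight_mscale)
  ultimately show ?thesis
    unfolding W internal_direct_sum_def using fin by blast
qed

section \<open>Bounding the ideal from above and below\<close>

lemma add_closed_base: "add_closed base_ideal"
  by (simp add: add_closed_def base_0 base_add)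

lemma add_closed_FGH:
  "add_closed (F i j ` base_ideal)" "add_closed (G i j ` base_ideal)" "add_closed (H i j ` base_ideal)"
  by (intro add_closed_image add_closed_base; simp add: FGH_add)+

lemma add_closed_Delta: "add_closed (Delta smul bar \<rho> base_ideal :: ('r, 'n) gl2n set)"
  unfolding Delta_def
  by (intro add_closed_plus add_closed_sum) (auto intro: add_closed_FGH add_closed_plus)

lemma Delta_FGH:
  fixes i j :: 'n
  assumes "a \<in> base_ideal"
  shows "i \<noteq> j \<Longrightarrow> F i j a \<in> Delta smul bar \<rho> base_ideal"
    and "G i j a \<in> Delta smul bar \<rho> base_ideal"
    and "H i j a \<in> Delta smul bar \<rho> base_ideal"
proof -
  let ?f = "\<Sum>(i, j)\<in>{(i :: 'n, j). i \<noteq> j}. F i j ` base_ideal"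
  let ?gh = "\<Sum>(i, j)\<in>{(i :: 'n, j). i \<le> j}. G i j ` base_ideal + H i j ` base_ideal"
  have img0: "0 \<in> F i j ` base_ideal" "0 \<in> G i j ` base_ideal" "0 \<in> H i j ` base_ideal" for i j :: 'n
    by (intro add_closed_zero add_closed_FGH)+
  have gh0: "0 \<in> G i j ` base_ideal + H i j ` base_ideal" for i j :: 'n
    by (intro add_closed_zero add_closed_plus add_closed_FGH)
  have f0: "0 \<in> ?f" and g0: "0 \<in> ?gh"
    by (intro add_closed_zero add_closed_sum; auto intro: add_closed_FGH add_closed_plus)+
  have f: "x \<in> Delta smul bar \<rho> base_ideal" if "x \<in> ?f" for x
    unfolding Delta_def using set_plus_intro[OF that g0] by simp
  have gh: "x \<in> Delta smul bar \<rho> base_ideal" if "x \<in> ?gh" for x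
    unfolding Delta_def using set_plus_intro[OF f0 that] by simp
  show "F i j a \<in> Delta smul bar \<rho> base_ideal" if "i \<noteq> j"
    using that assms img0 by (intro f mem_set_sum[where i = "(i, j)"]) auto
  have G: "G i j a \<in> Delta smul bar \<rho> base_ideal" if "i \<le> j" "a \<in> base_ideal" for i j :: 'n and a
  proof -
    have "G i j a + 0 \<in> G i j ` base_ideal + H i j ` base_ideal"
      using that img0 by (intro set_plus_intro) auto
    then show ?thesis using that gh0 by (intro gh mem_set_sum[where i = "(i, j)"]) auto
  qed
  have H: "H i j a \<in> Delta smul bar \<rho> base_ideal" if "i \<le> j" "a \<in> base_ideal" for i j :: 'n and a
  proof -
    have "0 + H i j a \<in> G i j ` base_ideal + H i j ` base_ideal"
      using that img0 by (intro set_plus_intro) auto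
    then show ?thesis using that gh0 by (intro gh mem_set_sum[where i = "(i, j)"]) auto
  qed
  \<comment> \<open>For \<open>i > j\<close> the element is rewritten at \<open>(j, i)\<close>; its
    new coefficient stays in the ideal because the ideal is closed under \<open>bar\<close> and
    scalars.\<close>
  have b: "smul (- \<rho>) (bar a) \<in> base_ideal" using assms base_bar base_scale by blast
  have "G i j a = G j i (smul (- \<rho>) (bar a))" "H i j a = H j i (smul (- \<rho>) (bar a))"
    unfolding FGH_smul by (rule G_swap, rule H_swap)
  then show "G i j a \<in> Delta smul bar \<rho> base_ideal" "H i j a \<in> Delta smul bar \<rho> base_ideal"
    using G[of i j a] H[of i j a] G[of j i, OF _ b] H[of j i, OF _ b] assms
    by (cases "i \<le> j"; simp)+
qed

lemma component_Delta:
  assumes "x \<in> K" "p \<noteq> q"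
  shows "component (rt p q) x \<in> Delta smul bar \<rho> base_ideal"
proof -
  note sk = skew_K[OF assms(1)] and cm = component_mem[OF assms(1)]
  have F: "component (rt (Inl i) (Inl j)) x \<in> Delta smul bar \<rho> base_ideal" if "i \<noteq> j" for i j
    using cm[of "Inl i" "Inl j"] that Delta_FGH(1) by (simp add: component_FGH[OF sk] F_mem_iff)
  have G: "component (rt (Inl i) (Inr j)) x \<in> Delta smul bar \<rho> base_ideal" for i j
  proof (cases "i = j")
    case True
    \<comment> \<open>No analogue of \<open>G_mem_iff\<close> is available for equal indices; the
      equality of images in \<open>GG_image\<close> supplies a coefficient from
      \<open>base_ideal\<close>.\<close>
    have "G i i (smul (1/2) (x $ Inl i $ Inr i)) \<in> G i i ` base_ideal"
      using cm[of "Inl i" "Inr i"] GG_image[of i] unfolding component_FGH[OF sk] by blast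
    then show ?thesis using True Delta_FGH(2) by (auto simp: component_FGH[OF sk])
  next
    case False
    then show ?thesis
      using cm[of "Inl i" "Inr j"] Delta_FGH(2) by (simp add: component_FGH[OF sk] G_mem_iff)
  qed
  have H: "component (rt (Inr i) (Inl j)) x \<in> Delta smul bar \<rho> base_ideal" for i j
  proof (cases "i = j")
    case True
    have "H i i (smul (1/2) (x $ Inr i $ Inl i)) \<in> H i i ` base_ideal"
      using cm[of "Inr i" "Inl i"] HH_image[of i] unfolding component_FGH[OF sk] by blast
    then show ?thesis using True Delta_FGH(3) by (auto simp: component_FGH[OF sk])
  next
    case False
    then show ?thesis
      using cm[of "Inr i" "Inl j"] Delta_FGH(3) by (simp add: component_FGH[OF sk] H_mem_iff)
  qed
  show ?thesis
  proof (cases p; cases q)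
    fix i j assume "p = Inr i" "q = Inr j"
    then show ?thesis using F[of j i] rt_opp[of "Inr j" "Inr i"] assms(2) by simp
  qed (use F G H assms(2) in auto)
qed

lemma K_subset_g_tilde: "K \<subseteq> g_tilde smul bar \<rho> base_ideal"
proof
  fix x assume xK: "x \<in> K"
  let ?R = "range (\<lambda>(p, q). rt p q) :: (('r, 'n) gl2n \<Rightarrow> 'k) set"
  let ?x0 = "component (\<lambda>h. 0) x"
  \<comment> \<open>Any diagonal position has weight 0, so an arbitrary one may be used
    here.\<close>
  have x0: "?x0 \<in> K" using component_mem[OF xK, of undefined undefined] by simp
  define a where "a i = ?x0 $ Inl i $ Inl i" for i
  have eq: "?x0 = (\<Sum>i\<in>UNIV. F i i (a i))"
    unfolding a_def using diagonal_FF[OF skew_K[OF x0]] has_weight_component[of "\<lambda>h. 0" x]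
    by (simp add: diagonal_weight_iff)
  define c where "c = smul (1 / of_nat CARD('n)) (\<Sum>i\<in>UNIV. a i)"
  note d = diagonal_mem_K[of a, folded c_def, folded eq, OF x0]
  have "(\<Sum>i\<in>UNIV. F i i c) \<in> f_scalar bar ((bar_eigenspace smul bar 1 + comm_span smul UNIV UNIV)
      \<inter> comm_hat base_ideal \<inter> plus_hat bar base_ideal)"
    using d(1) by (auto simp: f_scalar_def)
  moreover have "(\<Sum>i\<in>UNIV - {fst_idx}. F i i (a i - c) - F fst_idx fst_idx (a i - c))
      \<in> f_diff bar base_ideal"
    unfolding f_diff_def using d(2) by (intro sum_mem_set_sum) auto
  moreover have "(\<Sum>\<alpha>\<in>?R - {\<lambda>h. 0}. component \<alpha> x) \<in> Delta smul bar \<rho> base_ideal"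
  proof (rule add_closed_sum_mem[OF add_closed_Delta])
    fix \<alpha> assume "\<alpha> \<in> ?R - {\<lambda>h. 0}"
    then obtain p q where "\<alpha> = rt p q" "p \<noteq> q" by (auto simp: rt_eq_0_iff)
    then show "component \<alpha> x \<in> Delta smul bar \<rho> base_ideal" using component_Delta[OF xK] by simp
  qed
  ultimately have "?x0 + (\<Sum>\<alpha>\<in>?R - {\<lambda>h. 0}. component \<alpha> x) \<in> g_tilde smul bar \<rho> base_ideal"
    unfolding g_tilde_def d(3) by (intro set_plus_intro)
  also have "?x0 + (\<Sum>\<alpha>\<in>?R - {\<lambda>h. 0}. component \<alpha> x) = (\<Sum>\<alpha>\<in>?R. component \<alpha> x)"
    using sum.remove[OF _ zero_in_range_rt, of "\<lambda>\<alpha>. component \<alpha> x"] by simp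
  also have "\<dots> = x" by (rule sum_component_eq)
  finally show "x \<in> g_tilde smul bar \<rho> base_ideal" .
qed

lemma g_under_subset_K: "g_under smul bar \<rho> base_ideal \<subseteq> K"
  unfolding g_under_def f_diff_def Delta_def
proof (intro set_plus_subset set_sum_subset add_closed_K)
  show "F fst_idx fst_idx ` (base_ideal \<inter> bar_eigenspace smul bar 1 + comm_span smul base_ideal UNIV) \<subseteq> K"
    using FF_mem by blast
  have GH: "G i j a \<in> K" "H i j a \<in> K" if "a \<in> base_ideal" for i j a
    using that by (cases "i = j"; simp add: G_mem_iff H_mem_iff GG_mem HH_mem)+
  have "G i j ` base_ideal + H i j ` base_ideal \<subseteq> K" for i j
    using GH by (intro set_plus_subset add_closed_K) auto
  then show "(case ij of (i, j) \<Rightarrow> G i j ` base_ideal + H i j ` base_ideal) \<subseteq> K" for ij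
    by (cases ij) simp
qed (auto simp: FF_diff_mem F_mem_iff)

end

theorem theorem2p17:
  fixes smul :: "'k::field_char_0 \<Rightarrow> 'r::ring_1 \<Rightarrow> 'r"
    and bar :: "'r \<Rightarrow> 'r"
    and \<rho> :: 'k
    and \<J> :: "('r, 'n::{finite,linorder}) gl2n set"
  assumes "involutive_algebra smul bar"
    and "\<rho> \<in> {1, -1}"
    and "CARD('n) \<ge> 3"
    and "lie_ideal smul (lie_g smul bar \<rho>) \<J>"
  shows "\<exists>J.
    (involutive_ideal smul bar J \<and>
     (\<forall>i j. i \<noteq> j \<longrightarrow>
        {a. f_mat bar i j a \<in> \<J>} = J \<and>
        {a. g_mat smul bar \<rho> i j a \<in> \<J>} = J \<and>
        {a. h_mat smul bar \<rho> i j a \<in> \<J>} = J)) \<and>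
    (\<forall>i j. i \<noteq> j \<longrightarrow> {a. f_mat bar i i a - f_mat bar j j a \<in> \<J>} = J) \<and>
    (\<exists>I. (\<forall>i. {a. f_mat bar i i a \<in> \<J>} = I) \<and>
       (J \<inter> bar_eigenspace smul bar 1) + comm_span smul J UNIV \<subseteq> I \<and>
       I \<subseteq> (bar_eigenspace smul bar 1 + comm_span smul UNIV UNIV) \<inter> J) \<and>
    ((J \<inter> bar_eigenspace smul bar (-\<rho>)) \<inter> bar_eigenspace smul bar \<rho> = {0} \<and>
     (\<forall>i. let Jg = {a. g_mat smul bar \<rho> i i a \<in> \<J>}; Jh = {a. h_mat smul bar \<rho> i i a \<in> \<J>} in
        bar ` Jg = Jg \<and> bar ` Jh = Jh \<and>
        J \<subseteq> Jg \<and> Jg \<subseteq> (J \<inter> bar_eigenspace smul bar (-\<rho>)) + bar_eigenspace smul bar \<rho> \<and>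
        J \<subseteq> Jh \<and> Jh \<subseteq> (J \<inter> bar_eigenspace smul bar (-\<rho>)) + bar_eigenspace smul bar \<rho> \<and>
        g_mat smul bar \<rho> i i ` Jg = g_mat smul bar \<rho> i i ` J \<and>
        h_mat smul bar \<rho> i i ` Jh = h_mat smul bar \<rho> i i ` J)) \<and>
    (let A = f_scalar bar (bar_eigenspace smul bar 1 + comm_span smul UNIV UNIV) \<inter> \<J>;
         B = f_diff bar UNIV \<inter> \<J>
     in A \<inter> B = {0} \<and>
        internal_direct_sum (mscale smul) (insert None (Some ` roots_C smul))
          (\<lambda>t. case t of None \<Rightarrow> A + B | Some \<alpha> \<Rightarrow> root_space smul bar \<rho> \<alpha> \<inter> \<J>) \<J>) \<and>
    \<J> \<subseteq> g_tilde smul bar \<rho> J \<and> g_under smul bar \<rho> J \<subseteq> \<J>"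
proof -
  from assms interpret involutive_algebra smul bar by simp
  interpret involutive_lie_ideal smul bar \<rho> \<J>
    using assms by unfold_locales auto
  have bar: "bar ` {a. G i i a \<in> \<J>} = {a. G i i a \<in> \<J>}"
    "bar ` {a. H i i a \<in> \<J>} = {a. H i i a \<in> \<J>}" for i
    by (intro image_bar_eq; simp add: GG_HH_bar K_neg K_scale)+
  let ?A = "f_scalar bar (bar_eigenspace smul bar 1 + comm_span smul UNIV UNIV) :: ('r, 'n) gl2n set"
  \<comment> \<open>\<open>scalar_diff_disjoint\<close> bounds the intersection by {0}; that 0
    belongs to both spaces is checked separately.\<close>
  have "0 \<in> ?A"
    unfolding f_scalar_def by (rule image_eqI[of _ _ 0])
      (simp_all add: mem_sym_plus_comm_iff subspace_0[OF subspace_comm_span])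
  moreover have "(0 :: ('r, 'n) gl2n) \<in> f_diff bar UNIV"
    unfolding f_diff_def
    by (intro add_closed_zero add_closed_sum add_closed_image) (auto simp: add_closed_def FGH_add)
  ultimately have disj: "(?A \<inter> \<J>) \<inter> (f_diff bar UNIV \<inter> \<J>) = {0}"
    using scalar_diff_disjoint K_0 by blast
  have I: "\<exists>I. (\<forall>i. {a. F i i a \<in> \<J>} = I) \<and>
      (base_ideal \<inter> bar_eigenspace smul bar 1) + comm_span smul base_ideal UNIV \<subseteq> I \<and>
      I \<subseteq> (bar_eigenspace smul bar 1 + comm_span smul UNIV UNIV) \<inter> base_ideal"
    using FF_move FF_mem FF_mem_sym FF_mem_base
    by (intro exI[of _ "{a. F fst_idx fst_idx a \<in> \<J>}"]) blast
  have offdiag: "{a. F i j a \<in> \<J>} = base_ideal" "{a. G i j a \<in> \<J>} = base_ideal"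
    "{a. H i j a \<in> \<J>} = base_ideal" "{a. F i i a - F j j a \<in> \<J>} = base_ideal" if "i \<noteq> j" for i j
    using that by (simp_all add: F_mem_iff G_mem_iff H_mem_iff FF_diff_mem_iff)
  have diag: "base_ideal \<subseteq> {a. G i i a \<in> \<J>}" "base_ideal \<subseteq> {a. H i i a \<in> \<J>}"
    "{a. G i i a \<in> \<J>} \<subseteq> base_ideal \<inter> bar_eigenspace smul bar (- \<rho>) + bar_eigenspace smul bar \<rho>"
    "{a. H i i a \<in> \<J>} \<subseteq> base_ideal \<inter> bar_eigenspace smul bar (- \<rho>) + bar_eigenspace smul bar \<rho>"
    for i
    using GG_mem HH_mem GG_mem_base HH_mem_base eigenspace_decomposition by blast+
  show ?thesis
    unfolding Let_def
    by (rule exI[of _ base_ideal]) (intro conjI allI impI involutive_base_ideal offdiag I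
        eigenspaces_disjoint bar diag GG_image HH_image disj root_decomposition
        K_subset_g_tilde g_under_subset_K)
qed

end
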